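(* Let $\gamma\in(0,\infty)$ and suppose $p=p_n$ satisfies $p_n/n\to\gamma$ as $n\to\infty$. Let $\widetilde f$ be a prediction procedure and $\ell:\mathbb{R}\times\mathbb{R}\to\mathbb{R}_{\ge0}$ a loss that is convex in its second argument. Suppose there is a function $R^{\mathrm{det}}(\cdot;\widetilde f):(0,\infty]\to[0,\infty]$ whose restriction to $[\gamma,\infty]$ is proper and lower semicontinuous, and, with $$\mathcal{M}_\gamma^{\mathrm{zs}}=\arg\min_{\zeta:\,\zeta\ge\gamma}R^{\mathrm{det}}(\zeta;\widetilde f),$$ suppose that: (a) $R(\widetilde f(\cdot;\mathcal{D}_{k_m}))$ is uniformly bounded away from $0$; (b) for datasets $\mathcal{D}_{k_m}$ with $k_m$ observations and $p_m$ features, $R(\widetilde f(\cdot;\mathcal{D}_{k_m}))\to R^{\mathrm{det}}(\phi;\widetilde f)$ in probability as $k_m,p_m\to\infty$ and $p_m/k_m\to\phi\in\mathcal{M}_\gamma^{\mathrm{zs}}$; (c) $R^{\mathrm{det}}(\cdot;\widetilde f)$ is continuous on $\mathcal{M}_\gamma^{\mathrm{zs}}$ (as a function on $[\gamma,\infty]$); (d) either (O1) $\widehat\sigma_\Xi=O_p(1)$ and $\min_{\xi\in\Xi_n}R^{\mathrm{det}}(p_n/n_\xi;\widetilde f)\,\sqrt{n_{\mathrm{te}}/\log n}\to\infty$, or (O2) $\widehat\kappa_\Xi=O_p(1)$. Let $\widehat f^{\mathrm{zs}}$ be the zero-step predictor based on $\widetilde f$ with parameter $M$ (see context). Then for any $M\ge1$,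 as $n\to\infty$, $$\left(R(\widehat f^{\mathrm{zs}};\mathcal{D}_n)-\min_{\zeta\ge\gamma}R^{\mathrm{det}}(\zeta;\widetilde f)\right)_+=o_p(1).$$
   Context: $\mathcal{D}_n$ consists of $n$ i.i.d. observations $(X_i,Y_i)\in\mathbb{R}^{p_n}\times\mathbb{R}$ from a distribution $P$ (which may depend on $n$); likewise a dataset $\mathcal{D}_{k}$ with $k$ observations and $p$ features consists of i.i.d. pairs in $\mathbb{R}^p\times\mathbb{R}$ (in particular (b) covers datasets formed by subsets of $\mathcal{D}_n$). $(X_0,Y_0)\sim P$ is independent of everything else. A prediction procedure $\widetilde f$ maps a dataset $\mathcal{D}$ to a predictor $\widetilde f(\cdot;\mathcal{D}):\mathbb{R}^p\to\mathbb{R}$. The conditional risk of a predictor $f$ computed from the data is $R(f)=\int\ell(y,f(x))\,dP(x,y)$; $R(\widehat f^{\mathrm{zs}};\mathcal{D}_n)$ is the conditional risk of $\widehat f^{\mathrm{zs}}$. Proper means not identically $+\infty$. $(a)_+=\max\{a,0\}$. Zero-step procedure: fix $\nu\in(0,1)$; let $n_{\mathrm{te}}<n$, $n_{\mathrm{tr}}=n-n_{\mathrm{te}}$, where $n_{\mathrm{te}}/n\to0$ and $\log n/n_{\mathrm{te}}\to0$. Put $\Xi_n=\{1,2,\dots,\lceil n_{\mathrm{tr}}/\lfloor n^{\nu}\rfloor-2\rceil\}$ and $n_\xi=n_{\mathrm{tr}}-\xi\lfloor n^\nu\rfloor$. Split $\mathcal{D}_n$ at random into $\mathcal{D}_{\mathrm{tr}}$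 (size $n_{\mathrm{tr}}$) and $\mathcal{D}_{\mathrm{te}}$ (size $n_{\mathrm{te}}$, index set $\mathcal{I}_{\mathrm{te}}$). For $\xi\in\Xi_n$ and $1\le j\le M$ let $\mathcal{D}_{\mathrm{tr}}^{\xi,j}$ be random subsets of $\mathcal{D}_{\mathrm{tr}}$ of size $n_\xi$, drawn independently over $j$ (with replacement) uniformly from all subsets of that size, and set $\widehat f^{\xi}(x)=\frac1M\sum_{j=1}^M\widetilde f(x;\mathcal{D}_{\mathrm{tr}}^{\xi,j})$. Let $\widehat R(\widehat f^{\xi})$ be either the average of $\ell(Y_i,\widehat f^{\xi}(X_i))$, $i\in\mathcal{I}_{\mathrm{te}}$ (choice $\mathtt{AVG}$), or their median-of-means (choice $\mathtt{MOM}$) with $\eta=n^{-A}/|\Xi_n|$ for a fixed $A>0$, i.e. the median of the averages over $\lceil8\log(1/\eta)\rceil$ batches of these values. Let $\widehat\xi\in\arg\min_{\xi\in\Xi_n}\widehat R(\widehat f^\xi)$ and $\widehat f^{\mathrm{zs}}=\widehat f^{\widehat\xi}$. Definitions: $\widehat\sigma_\xi$ is the conditional norm (given the data) of $\ell(Y_0,\widehat f^\xi(X_0))$: the $\psi_1$ norm $\inf\{C>0:\mathbb{E}[\exp(|\ell(Y_0,\widehat f^\xi(X_0))|/C)\mid\mathcal{D}_n]\le2\}$ if $\mathtt{AVG}$ is used, and either this $\psi_1$ norm or the $L_2$ norm $(\mathbb{E}[\ell(Y_0,\widehat f^\xi(X_0))^2\mid\mathcal{D}_n])^{1/2}$ if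 $\mathtt{MOM}$ is used. $\widehat\sigma_\Xi=\max_{\xi\in\Xi_n}\widehat\sigma_\xi$ and $\widehat\kappa_\Xi=\max_{\xi\in\Xi_n}\widehat\sigma_\xi/R(\widehat f^\xi)$. *)

theory Defs
  imports "HOL-Probability.Probability"
begin

text \<open>The number of features varies with \<open>n\<close>, so a vector in \<open>\<real>\<^sup>p\<close> is a function on
  \<open>{..<p}\<close>. A dataset is a list of observations, and a prediction procedure maps the number of
  features and a dataset to a predictor. Neither symmetry nor any other property of the procedure
  is built into the type.\<close>

type_synonym feature = "nat \<Rightarrow> real"
type_synonym obs = "feature \<times> real"
type_synonym procedure = "nat \<Rightarrow> obs list \<Rightarrow> feature \<Rightarrow> real"

definition feature_space :: "nat \<Rightarrow> feature measure" where
  "feature_space p = PiM {..<p} (\<lambda>_. borel)"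

definition obs_space :: "nat \<Rightarrow> obs measure" where
  "obs_space p = feature_space p \<Otimes>\<^sub>M borel"

definition iid_law :: "obs measure \<Rightarrow> nat \<Rightarrow> (nat \<Rightarrow> obs) measure" where
  "iid_law P k = PiM {..<k} (\<lambda>_. P)"

definition dataset :: "(nat \<Rightarrow> obs) \<Rightarrow> nat set \<Rightarrow> obs list" where
  "dataset D I = map D (sorted_list_of_set I)"

definition measurable_procedure :: "procedure \<Rightarrow> bool" where
  "measurable_procedure ft \<longleftrightarrow>
     (\<forall>p k. (\<lambda>(D, x). ft p (dataset D {..<k}) x)
        \<in> borel_measurable (PiM {..<k} (\<lambda>_. obs_space p) \<Otimes>\<^sub>M feature_space p))"

definition risk :: "(real \<Rightarrow> real \<Rightarrow> real) \<Rightarrow> obs measure \<Rightarrow> (feature \<Rightarrow> real) \<Rightarrow> ennreal" where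
  "risk l P f = (\<integral>\<^sup>+(x, y). ennreal (l y (f x)) \<partial>P)"

subsection \<open>Stochastic order and semicontinuity\<close>

text \<open>The variables below are nonnegative and may take the value \<open>\<infinity>\<close>, which counts as
  exceeding every real bound.\<close>

definition small_o_p :: "(nat \<Rightarrow> 'w measure) \<Rightarrow> (nat \<Rightarrow> 'w \<Rightarrow> ennreal) \<Rightarrow> bool" where
  "small_o_p \<Omega> X \<longleftrightarrow>
     (\<forall>e>0. (\<lambda>n. measure (\<Omega> n) {w \<in> space (\<Omega> n). ennreal e < X n w}) \<longlonglongrightarrow> 0)"

definition big_O_p :: "(nat \<Rightarrow> 'w measure) \<Rightarrow> (nat \<Rightarrow> 'w \<Rightarrow> ennreal) \<Rightarrow> bool" where
  "big_O_p \<Omega> X \<longleftrightarrow>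
     (\<forall>e>0. \<exists>C. \<forall>\<^sub>F n in sequentially.
        measure (\<Omega> n) {w \<in> space (\<Omega> n). ennreal C < X n w} \<le> e)"

text \<open>Subtraction on \<^typ>\<open>ennreal\<close> truncates at \<open>0\<close>, so the sum of the two differences is the
  distance between \<open>X\<close> and \<open>c\<close>; this is meant for finite \<open>c\<close>.\<close>

definition tendsto_in_prob ::
    "(nat \<Rightarrow> 'w measure) \<Rightarrow> (nat \<Rightarrow> 'w \<Rightarrow> ennreal) \<Rightarrow> ennreal \<Rightarrow> bool" where
  "tendsto_in_prob \<Omega> X c \<longleftrightarrow> small_o_p \<Omega> (\<lambda>n w. (X n w - c) + (c - X n w))"

definition lower_semicontinuous_on :: "ennreal set \<Rightarrow> (ennreal \<Rightarrow> ennreal) \<Rightarrow> bool" where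
  "lower_semicontinuous_on S g \<longleftrightarrow> (\<forall>z\<in>S. g z \<le> Liminf (at z within S) g)"

definition proper_on :: "ennreal set \<Rightarrow> (ennreal \<Rightarrow> ennreal) \<Rightarrow> bool" where
  "proper_on S g \<longleftrightarrow> (\<exists>z\<in>S. g z < \<infinity>)"

text \<open>The set \<open>\<M>\<^sub>\<gamma>\<close> of minimisers over \<open>[\<gamma>, \<infinity>]\<close>.\<close>

definition minimizers :: "real \<Rightarrow> (ennreal \<Rightarrow> ennreal) \<Rightarrow> ennreal set" where
  "minimizers \<gamma> g = {z. is_arg_min g (\<lambda>z. ennreal \<gamma> \<le> z) z}"

text \<open>Sequences of datasets with \<open>k m\<close> observations from the \<open>N m\<close>-th distribution, which has
  \<open>p (N m)\<close> features, such that both numbers tend to infinity with aspect ratio tending to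
  \<open>\<phi> \<in> (0, \<infinity>]\<close>.\<close>

definition proportional ::
    "(nat \<Rightarrow> nat) \<Rightarrow> (nat \<Rightarrow> nat) \<Rightarrow> (nat \<Rightarrow> nat) \<Rightarrow> ennreal \<Rightarrow> bool" where
  "proportional p N k \<phi> \<longleftrightarrow>
     filterlim k at_top sequentially \<and> filterlim (\<lambda>m. p (N m)) at_top sequentially \<and>
     (\<lambda>m. ennreal (real (p (N m)) / real (k m))) \<longlonglongrightarrow> \<phi>"

subsection \<open>The zero-step procedure\<close>

definition step :: "real \<Rightarrow> nat \<Rightarrow> nat" where
  "step \<nu> n = nat \<lfloor>real n powr \<nu>\<rfloor>"

definition grid :: "real \<Rightarrow> nat \<Rightarrow> nat \<Rightarrow> nat set" where
  "grid \<nu> n nte = {1..nat \<lceil>real (n - nte) / real (step \<nu> n) - 2\<rceil>}"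

text \<open>The subtraction does not truncate for \<open>\<xi>\<close> in the grid and \<open>n \<ge> 1\<close>, where the value
  exceeds \<open>step \<nu> n\<close>.\<close>

definition sub_size :: "real \<Rightarrow> nat \<Rightarrow> nat \<Rightarrow> nat \<Rightarrow> nat" where
  "sub_size \<nu> n nte \<xi> = n - nte - \<xi> * step \<nu> n"

definition average_predictor ::
    "procedure \<Rightarrow> nat \<Rightarrow> nat \<Rightarrow> (nat \<Rightarrow> obs) \<Rightarrow> (nat \<Rightarrow> nat set) \<Rightarrow> feature \<Rightarrow> real" where
  "average_predictor ft p M D S x = (\<Sum>j=1..M. ft p (dataset D (S j)) x) / real M"

text \<open>\<open>T w\<close> is the test index set and \<open>S w \<xi> j\<close> the index set of the \<open>j\<close>-th subset for \<open>\<xi>\<close>.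
  For every \<open>\<xi>\<close> the test set is uniform and, given it, the \<open>M\<close> subsets are independent and
  uniform among the subsets of the training indices of the prescribed size. The dependence
  between different \<open>\<xi>\<close> is left open.\<close>

definition random_draws ::
    "'w measure \<Rightarrow> nat \<Rightarrow> nat \<Rightarrow> nat set \<Rightarrow> (nat \<Rightarrow> nat) \<Rightarrow> nat
      \<Rightarrow> ('w \<Rightarrow> nat set) \<Rightarrow> ('w \<Rightarrow> nat \<Rightarrow> nat \<Rightarrow> nat set) \<Rightarrow> bool" where
  "random_draws \<Omega> n nte \<Xi> sz M T S \<longleftrightarrow>
     (\<forall>w\<in>space \<Omega>. T w \<subseteq> {..<n} \<and> card (T w) = nte \<and>
        (\<forall>\<xi>\<in>\<Xi>. \<forall>j\<in>{1..M}. S w \<xi> j \<subseteq> {..<n} - T w \<and> card (S w \<xi> j) = sz \<xi>)) \<and>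
     (\<forall>\<xi>\<in>\<Xi>. distr \<Omega> (count_space UNIV) (\<lambda>w. (T w, restrict (S w \<xi>) {1..M})) =
        measure_pmf
          (bind_pmf (pmf_of_set {I. I \<subseteq> {..<n} \<and> card I = nte}) (\<lambda>I.
             map_pmf (Pair I)
               (Pi_pmf {1..M} undefined
                 (\<lambda>_. pmf_of_set {J. J \<subseteq> {..<n} - I \<and> card J = sz \<xi>})))))"

text \<open>Independence of two random variables of different types
  (\<^const>\<open>prob_space.indep_var\<close> needs a common type).\<close>

definition indep_rvs ::
    "'w measure \<Rightarrow> 'a measure \<Rightarrow> ('w \<Rightarrow> 'a) \<Rightarrow> 'b measure \<Rightarrow> ('w \<Rightarrow> 'b) \<Rightarrow> bool" where
  "indep_rvs \<Omega> MX X MY Y \<longleftrightarrow>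
     X \<in> measurable \<Omega> MX \<and> Y \<in> measurable \<Omega> MY \<and>
     prob_space.indep_set \<Omega>
       {X -` A \<inter> space \<Omega> |A. A \<in> sets MX} {Y -` B \<inter> space \<Omega> |B. B \<in> sets MY}"

subsection \<open>Empirical risk\<close>

definition median :: "real list \<Rightarrow> real" where
  "median xs = (sort xs ! ((length xs - 1) div 2) + sort xs ! (length xs div 2)) / 2"

definition mean_loss ::
    "(real \<Rightarrow> real \<Rightarrow> real) \<Rightarrow> (nat \<Rightarrow> obs) \<Rightarrow> nat set \<Rightarrow> (feature \<Rightarrow> real) \<Rightarrow> real" where
  "mean_loss l D I f = (\<Sum>i\<in>I. l (snd (D i)) (f (fst (D i)))) / real (card I)"

datatype centering = AVG | MOM

definition num_batches :: "real \<Rightarrow> nat \<Rightarrow> nat set \<Rightarrow> nat" where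
  "num_batches A n \<Xi> =
     (let \<eta> = real n powr (- A) / real (card \<Xi>) in nat \<lceil>8 * ln (1 / \<eta>)\<rceil>)"

text \<open>The function \<open>b\<close> assigns to every test index the number of its batch.\<close>

definition balanced_batches :: "nat \<Rightarrow> nat set \<Rightarrow> (nat \<Rightarrow> nat) \<Rightarrow> bool" where
  "balanced_batches B I b \<longleftrightarrow>
     b ` I \<subseteq> {..<B} \<and>
     (\<forall>c<B. int (card {i\<in>I. b i = c})
        \<in> {\<lfloor>real (card I) / real B\<rfloor>, \<lceil>real (card I) / real B\<rceil>})"

fun empirical_risk ::
    "centering \<Rightarrow> (real \<Rightarrow> real \<Rightarrow> real) \<Rightarrow> (nat \<Rightarrow> obs) \<Rightarrow> nat set \<Rightarrow> nat \<Rightarrow> (nat \<Rightarrow> nat)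
      \<Rightarrow> (feature \<Rightarrow> real) \<Rightarrow> real" where
  "empirical_risk AVG l D I B b f = mean_loss l D I f"
| "empirical_risk MOM l D I B b f =
     median (map (\<lambda>c. mean_loss l D {i\<in>I. b i = c} f) [0..<B])"

subsection \<open>Conditional norms of the loss\<close>

datatype norm_kind = Psi1 | L2

text \<open>In both cases the value is \<open>\<infinity>\<close> if the norm is not finite.\<close>

fun loss_norm ::
    "norm_kind \<Rightarrow> (real \<Rightarrow> real \<Rightarrow> real) \<Rightarrow> obs measure \<Rightarrow> (feature \<Rightarrow> real) \<Rightarrow> ennreal" where
  "loss_norm Psi1 l P f =
     Inf {ennreal C |C. C > 0 \<and> (\<integral>\<^sup>+(x, y). ennreal (exp (\<bar>l y (f x)\<bar> / C)) \<partial>P) \<le> 2}"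
| "loss_norm L2 l P f =
     (let v = (\<integral>\<^sup>+(x, y). ennreal ((l y (f x))\<^sup>2) \<partial>P)
      in if v = \<infinity> then \<infinity> else ennreal (sqrt (enn2real v)))"

text \<open>Division on \<^typ>\<open>ennreal\<close> gives \<open>\<infinity> / \<infinity> = 0\<close>, which would hide an infinite norm; the ratio
  is set to \<open>\<infinity>\<close> there. The ratio of a loss that vanishes almost surely is \<open>0 / 0 = 0\<close>.\<close>

definition norm_ratio ::
    "norm_kind \<Rightarrow> (real \<Rightarrow> real \<Rightarrow> real) \<Rightarrow> obs measure \<Rightarrow> (feature \<Rightarrow> real) \<Rightarrow> ennreal" where
  "norm_ratio nk l P f =
     (if loss_norm nk l P f = \<infinity> then \<infinity> else loss_norm nk l P f / risk l P f)"

end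

theory Submission
  imports Defs
begin

text \<open>The zero-step predictor minimises an empirical risk over a grid of subsample sizes. Its risk is
  asymptotically at most the minimum \<open>r\<close> of the risk profile for two reasons: some grid point is
  asymptotically optimal, and choosing the grid point from the test data costs only \<open>o\<^sub>p(1)\<close>.

  The interval \<open>[\<gamma>, \<infinity>]\<close> is compact and the profile is lower semicontinuous and proper, so \<open>r\<close> is finite
  and attained at some \<open>z\<close> (\<open>minimizer_exists\<close>). The grid is spaced by \<open>n\<^sup>\<nu> = o(n)\<close> and its subsample
  sizes reach from order \<open>n\<^sup>\<nu>\<close> up to \<open>n - o(n)\<close>; hence it contains points whose size \<open>k\<close> tends to infinity
  with \<open>p / k \<longlonglongrightarrow> z\<close>, also if \<open>z = \<infinity>\<close> (\<open>reference_subsample_sizes\<close>). The observations in a subsample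
  chosen without looking at the data are i.i.d. (\<open>subset_risk_law\<close>), so the risk of each of the \<open>M\<close>
  predictors averaged at such a reference point tends to \<open>r\<close> in probability, and convexity of the loss
  bounds the risk of their average by the largest of the \<open>M\<close> risks (\<open>risk_average_le\<close>).

  For the selection, both alternatives of the last hypothesis provide a constant \<open>C\<close> such that, with
  probability close to one, the norm of the loss at every grid point is below \<open>C (1 + R)\<close>, where \<open>R\<close> is
  the risk there (\<open>norm_lt_of_norm_le\<close>, \<open>norm_lt_of_ratio_le\<close>). The predictors do not depend on the test
  data. So the empirical risk at a given grid point misses \<open>R\<close> by more than \<open>C (1 + R) t\<close>, with \<open>t\<close> of
  the order of the square root of \<open>log n / n\<^sub>t\<^sub>e\<close>, with a probability so small that it can be summed over
  the grid (\<open>empirical_risk_deviation\<close>). For the average this is Chernoff's bound for subexponential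
  losses. For the median of means, Chebyshev's inequality makes each batch fail with probability at most
  \<open>1/16\<close>, and the median only fails if half of the independent batches do. Writing \<open>\<tau> = C t\<close> and comparing
  the selected risk \<open>x\<close> with the risk \<open>y\<close> at the reference point yields
  \<open>x - \<tau> (1 + x) \<le> y + \<tau> (1 + y)\<close>, and \<open>\<tau> \<longlonglongrightarrow> 0\<close> while \<open>y\<close> stays bounded (\<open>selected_risk_le\<close>).

  The two probability estimates concern random data and a random split at once. The split takes
  countably many values and is independent of the data, so it may be fixed (\<open>indep_rvs_event_le\<close>); after
  that the training observations may be fixed by Fubini's theorem
  (\<open>product_measure_le_sections\<close>).\<close>

section \<open>Concentration of averages under a product measure\<close>

text \<open>The remainder of the exponential series is absorbed by \<open>exp y\<close>: one factor \<open>exp (y / 2)\<close> bounds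
  the exponential in Lagrange's remainder, a second one the square \<open>y\<^sup>2\<close>. Taking expectations, this
  controls the moment generating function by the single moment of \<open>exp y\<close>.\<close>

lemma exp_mult_le_quadratic:
  fixes y u :: real
  assumes "0 \<le> y" "\<bar>u\<bar> \<le> 1/2"
  shows "exp (u * y) \<le> 1 + u * y + 4 * u\<^sup>2 * exp y"
proof -
  obtain t where t: "\<bar>t\<bar> \<le> \<bar>u * y\<bar>"
    "exp (u * y) = (\<Sum>m<2. (u * y) ^ m / fact m) + exp t / fact 2 * (u * y) ^ 2"
    using Maclaurin_exp_le[of "u * y" 2] by blast
  have "t \<le> y / 2"
    using t(1) assms mult_right_mono[of "\<bar>u\<bar>" "1/2" y] by (simp add: abs_mult)
  then have "exp t \<le> exp (y / 2)" by simp
  moreover have "y\<^sup>2 / 2 \<le> 4 * exp (y / 2)"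
    using exp_lower_Taylor_quadratic[of "y / 2"] assms(1)
    by (simp add: power2_eq_square)
  ultimately have "exp t * (y\<^sup>2 / 2) \<le> exp (y / 2) * (4 * exp (y / 2))"
    by (intro mult_mono) auto
  also have "\<dots> = 4 * exp y" by (simp flip: exp_add)
  finally have "u\<^sup>2 * (exp t * (y\<^sup>2 / 2)) \<le> u\<^sup>2 * (4 * exp y)"
    by (intro mult_left_mono) auto
  with t(2) show ?thesis
    by (simp add: numeral_2_eq_2 power_mult_distrib algebra_simps)
qed

context prob_space begin

lemma integrable_of_exp_moment:
  fixes X :: "'a \<Rightarrow> real"
  assumes [measurable]: "X \<in> borel_measurable M" and "\<And>x. 0 \<le> X x"
    and "(\<integral>\<^sup>+x. ennreal (exp (X x)) \<partial>M) < \<infinity>"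
  shows "integrable M (\<lambda>x. exp (X x))" "integrable M X"
proof -
  show *: "integrable M (\<lambda>x. exp (X x))"
    by (rule integrableI_nonneg) (use assms in auto)
  have "norm (X x) \<le> norm (exp (X x))" for x
    using exp_ge_add_one_self[of "X x"] assms(2)[of x] by (simp del: exp_ge_add_one_self)
  then show "integrable M X"
    by (intro Bochner_Integration.integrable_bound[OF *]) auto
qed

text \<open>Near \<open>0\<close> the centred variable behaves like a Gaussian, because the linear term of the quadratic bound
  cancels against the mean.\<close>

lemma centered_mgf_le:
  fixes X :: "'a \<Rightarrow> real"
  assumes [measurable]: "X \<in> borel_measurable M" and nonneg: "\<And>x. 0 \<le> X x"
    and exp2: "(\<integral>\<^sup>+x. ennreal (exp (X x)) \<partial>M) \<le> 2" and u: "\<bar>u\<bar> \<le> 1/2"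
  shows "(\<integral>\<^sup>+x. ennreal (exp (u * (X x - expectation X))) \<partial>M) \<le> ennreal (exp (8 * u\<^sup>2))"
proof -
  let ?e = "expectation (\<lambda>x. exp (X x))"
  have fin: "(\<integral>\<^sup>+x. ennreal (exp (X x)) \<partial>M) < \<infinity>"
    using exp2 by (rule le_less_trans) auto
  note int = integrable_of_exp_moment[OF assms(1) nonneg fin]
  have e: "?e \<le> 2"
    using exp2 ennreal_le_iff[of 2 "?e"] by (subst (asm) nn_integral_eq_integral[OF int(1)]) auto
  let ?q = "\<lambda>x. 1 + u * X x + 4 * u\<^sup>2 * exp (X x)"
  have pos: "0 \<le> ?q x" for x
    using exp_mult_le_quadratic[OF nonneg u] exp_ge_zero order_trans by blast
  have "(\<integral>\<^sup>+x. ennreal (exp (u * X x)) \<partial>M) \<le> (\<integral>\<^sup>+x. ennreal (?q x) \<partial>M)"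
    by (intro nn_integral_mono ennreal_leI exp_mult_le_quadratic nonneg u)
  also have "\<dots> = ennreal (1 + u * expectation X + 4 * u\<^sup>2 * ?e)"
    using int pos by (subst nn_integral_eq_integral) (auto simp: prob_space)
  also have "\<dots> \<le> ennreal (exp (u * expectation X + 8 * u\<^sup>2))"
  proof (rule ennreal_leI)
    have "4 * u\<^sup>2 * ?e \<le> 4 * u\<^sup>2 * 2" by (intro mult_left_mono e) auto
    then show "1 + u * expectation X + 4 * u\<^sup>2 * ?e \<le> exp (u * expectation X + 8 * u\<^sup>2)"
      using exp_ge_add_one_self[of "u * expectation X + 8 * u\<^sup>2"] by linarith
  qed
  finally have *: "(\<integral>\<^sup>+x. ennreal (exp (u * X x)) \<partial>M) \<le> ennreal (exp (u * expectation X + 8 * u\<^sup>2))" .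
  have "(\<integral>\<^sup>+x. ennreal (exp (u * (X x - expectation X))) \<partial>M)
      = (\<integral>\<^sup>+x. ennreal (exp (- u * expectation X)) * ennreal (exp (u * X x)) \<partial>M)"
    by (intro nn_integral_cong) (simp add: algebra_simps flip: ennreal_mult exp_add)
  also have "\<dots> = ennreal (exp (- u * expectation X)) * (\<integral>\<^sup>+x. ennreal (exp (u * X x)) \<partial>M)"
    by (rule nn_integral_cmult) simp
  also have "\<dots> \<le> ennreal (exp (- u * expectation X)) * ennreal (exp (u * expectation X + 8 * u\<^sup>2))"
    by (intro mult_left_mono *) auto
  also have "\<dots> = ennreal (exp (8 * u\<^sup>2))"
    by (simp flip: ennreal_mult exp_add)
  finally show ?thesis .
qed

lemma product_measure_prob_space: "prob_space (PiM I (\<lambda>_. M))"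
  by (intro prob_space_PiM prob_space_axioms)

text \<open>Markov's inequality for the exponential of the sum, whose expectation factorises.\<close>

lemma product_chernoff:
  fixes g :: "'a \<Rightarrow> real"
  assumes "finite I" and [measurable]: "g \<in> borel_measurable M"
    and mgf: "(\<integral>\<^sup>+x. ennreal (exp (g x)) \<partial>M) \<le> ennreal (exp s)"
  shows "measure (PiM I (\<lambda>_. M)) {D \<in> space (PiM I (\<lambda>_. M)). a \<le> (\<Sum>i\<in>I. g (D i))}
    \<le> exp (real (card I) * s - a)"
proof -
  interpret I: prob_space "PiM I (\<lambda>_. M)" by (rule product_measure_prob_space)
  interpret product_sigma_finite "\<lambda>_. M" ..
  let ?E = "{D \<in> space (PiM I (\<lambda>_. M)). a \<le> (\<Sum>i\<in>I. g (D i))}"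
  have "emeasure (PiM I (\<lambda>_. M)) ?E = (\<integral>\<^sup>+D. indicator ?E D \<partial>PiM I (\<lambda>_. M))"
    by (subst nn_integral_indicator) (measurable)
  also have "\<dots> \<le> (\<integral>\<^sup>+D. ennreal (exp (- a)) * (\<Prod>i\<in>I. ennreal (exp (g (D i)))) \<partial>PiM I (\<lambda>_. M))"
    by (intro nn_integral_mono)
       (auto simp: prod_ennreal indicator_def simp flip: ennreal_mult exp_add exp_sum[OF assms(1)]
         ennreal_1)
  also have "\<dots> = ennreal (exp (- a)) * (\<Prod>i\<in>I. (\<integral>\<^sup>+x. ennreal (exp (g x)) \<partial>M))"
    using assms(1) by (subst nn_integral_cmult, measurable, subst product_nn_integral_prod) auto
  also have "\<dots> \<le> ennreal (exp (- a)) * (\<Prod>i\<in>I. ennreal (exp s))"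
    by (intro mult_left_mono prod_mono_ennreal mgf) auto
  also have "\<dots> = ennreal (exp (real (card I) * s - a))"
    by (simp add: ennreal_power exp_of_nat_mult[symmetric] flip: ennreal_mult exp_add)
  finally show ?thesis
    by (simp add: I.emeasure_eq_measure)
qed

text \<open>Chernoff's bound with parameter \<open>t / 16\<close> for either sign, which minimises the exponent
  \<open>8 u\<^sup>2 - u t\<close>. The parameter has to stay below \<open>1/2\<close>, hence the restriction to \<open>t \<le> 8\<close>.\<close>

lemma subexponential_mean_deviation:
  fixes X :: "'a \<Rightarrow> real"
  assumes "finite I" "I \<noteq> {}" and [measurable]: "X \<in> borel_measurable M" and nonneg: "\<And>x. 0 \<le> X x"
    and c: "0 < c" and exp2: "(\<integral>\<^sup>+x. ennreal (exp (X x / c)) \<partial>M) \<le> 2" and t: "0 \<le> t" "t \<le> 8"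
  shows "measure (PiM I (\<lambda>_. M)) {D \<in> space (PiM I (\<lambda>_. M)).
      c * t < \<bar>(\<Sum>i\<in>I. X (D i)) / real (card I) - expectation X\<bar>}
    \<le> 2 * exp (- (real (card I) * t\<^sup>2 / 32))"
proof -
  interpret I: prob_space "PiM I (\<lambda>_. M)" by (rule product_measure_prob_space)
  define m where "m = real (card I)"
  have m: "m > 0" using assms(1,2) by (simp add: m_def card_gt_0_iff)
  define g where "g = (\<lambda>u x. u * (X x / c - expectation X / c))"
  have mgf: "(\<integral>\<^sup>+x. ennreal (exp (g u x)) \<partial>M) \<le> ennreal (exp (8 * u\<^sup>2))" if "\<bar>u\<bar> \<le> 1/2" for u
    using centered_mgf_le[of "\<lambda>x. X x / c" u] that exp2 c nonneg by (simp add: g_def)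
  have sum: "(\<Sum>i\<in>I. g u (D i)) = u * m / c * ((\<Sum>i\<in>I. X (D i)) / m - expectation X)" for u D
  proof -
    have "(\<Sum>i\<in>I. g u (D i)) = u * ((\<Sum>i\<in>I. X (D i)) / c - m * (expectation X / c))"
      by (simp add: g_def m_def sum_subtractf sum_divide_distrib flip: sum_distrib_left)
    also have "\<dots> = u * m / c * ((\<Sum>i\<in>I. X (D i)) / m - expectation X)"
      using m c by (simp add: divide_simps right_diff_distrib) (simp add: algebra_simps)
    finally show ?thesis .
  qed
  \<comment> \<open>The threshold is \<open>m u t\<close> at \<open>u = t / 16\<close>.\<close>
  let ?E = "\<lambda>u. {D \<in> space (PiM I (\<lambda>_. M)). m * t\<^sup>2 / 16 \<le> (\<Sum>i\<in>I. g u (D i))}"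
  have [measurable]: "g u \<in> borel_measurable M" for u unfolding g_def by measurable
  have tail: "measure (PiM I (\<lambda>_. M)) (?E u) \<le> exp (- (m * t\<^sup>2 / 32))" if "\<bar>u\<bar> = t / 16" for u
  proof -
    have "measure (PiM I (\<lambda>_. M)) (?E u) \<le> exp (m * (8 * u\<^sup>2) - m * t\<^sup>2 / 16)"
      unfolding m_def by (rule product_chernoff[OF assms(1)]) (use mgf that t in auto)
    also have "u\<^sup>2 = t\<^sup>2 / 256"
      using power2_abs[of u] unfolding that by (simp add: power_divide)
    finally show ?thesis by simp
  qed
  have sub: "{D \<in> space (PiM I (\<lambda>_. M)). c * t < \<bar>(\<Sum>i\<in>I. X (D i)) / m - expectation X\<bar>}
      \<subseteq> ?E (t / 16) \<union> ?E (- (t / 16))"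
  proof
    fix D assume D: "D \<in> {D \<in> space (PiM I (\<lambda>_. M)). c * t < \<bar>(\<Sum>i\<in>I. X (D i)) / m - expectation X\<bar>}"
    define d where "d = (\<Sum>i\<in>I. X (D i)) / m - expectation X"
    have cd: "c * t \<le> \<bar>d\<bar>" and sp: "D \<in> space (PiM I (\<lambda>_. M))" using D by (simp_all add: d_def)
    have sumd: "(\<Sum>i\<in>I. g u (D i)) = u * m / c * d" for u by (simp only: sum d_def)
    have "t * m / (16 * c) * (c * t) \<le> t * m / (16 * c) * \<bar>d\<bar>"
      by (intro mult_left_mono cd) (use m c t in auto)
    moreover have "t * m / (16 * c) * (c * t) = m * t\<^sup>2 / 16"
      using c by (simp add: power2_eq_square field_simps)
    moreover have "t * m / (16 * c) * \<bar>d\<bar> = t / 16 * m / c * \<bar>d\<bar>" by simp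
    ultimately have "m * t\<^sup>2 / 16 \<le> t / 16 * m / c * \<bar>d\<bar>" by linarith
    then show "D \<in> ?E (t / 16) \<union> ?E (- (t / 16))"
      using sp by (cases "d \<ge> 0") (auto simp: sumd)
  qed
  have "measure (PiM I (\<lambda>_. M)) {D \<in> space (PiM I (\<lambda>_. M)). c * t < \<bar>(\<Sum>i\<in>I. X (D i)) / m - expectation X\<bar>}
      \<le> measure (PiM I (\<lambda>_. M)) (?E (t / 16) \<union> ?E (- (t / 16)))"
    by (intro I.finite_measure_mono sub) measurable
  also have "\<dots> \<le> measure (PiM I (\<lambda>_. M)) (?E (t / 16)) + measure (PiM I (\<lambda>_. M)) (?E (- (t / 16)))"
    by (intro measure_Un_le) measurable
  also have "\<dots> \<le> exp (- (m * t\<^sup>2 / 32)) + exp (- (m * t\<^sup>2 / 32))"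
    by (intro add_mono tail) (use t in auto)
  finally show ?thesis by (simp add: m_def)
qed

lemma indep_vars_coordinates:
  "prob_space.indep_vars (PiM I (\<lambda>_. M)) (\<lambda>_. M) (\<lambda>i D. D i) I"
proof (cases "I = {}")
  case True
  interpret I: prob_space "PiM I (\<lambda>_. M)" by (rule product_measure_prob_space)
  show ?thesis unfolding I.indep_vars_def I.indep_sets_def using True by simp
next
  case False
  interpret I: prob_space "PiM I (\<lambda>_. M)" by (rule product_measure_prob_space)
  show ?thesis
  proof (subst I.indep_vars_iff_distr_eq_PiM'[OF False])
    show "(\<lambda>D. D i) \<in> PiM I (\<lambda>_. M) \<rightarrow>\<^sub>M M" if "i \<in> I" for i
      using that by measurable
    have "distr (PiM I (\<lambda>_. M)) (PiM I (\<lambda>_. M)) (\<lambda>x. \<lambda>i\<in>I. x i)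
        = distr (PiM I (\<lambda>_. M)) (PiM I (\<lambda>_. M)) (\<lambda>x. x)"
      by (intro distr_cong) (auto simp: space_PiM)
    also have "\<dots> = PiM I (\<lambda>_. M)" by (rule distr_id)
    also have "\<dots> = PiM I (\<lambda>i. distr (PiM I (\<lambda>_. M)) M (\<lambda>x. x i))"
      by (intro PiM_cong refl distr_PiM_component[symmetric] prob_space_axioms)
    finally show "distr (PiM I (\<lambda>_. M)) (PiM I (\<lambda>_. M)) (\<lambda>x. \<lambda>i\<in>I. x i)
        = PiM I (\<lambda>i. distr (PiM I (\<lambda>_. M)) M (\<lambda>x. x i))" .
  qed
qed

lemma nn_integral_prod_blocks:
  fixes g :: "nat \<Rightarrow> (nat \<Rightarrow> 'a) \<Rightarrow> ennreal"
  assumes "finite C" and K: "\<And>c. c \<in> C \<Longrightarrow> K c \<subseteq> I" "disjoint_family_on K C"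
    and g: "\<And>c. c \<in> C \<Longrightarrow> g c \<in> borel_measurable (PiM (K c) (\<lambda>_. M))"
  shows "(\<integral>\<^sup>+D. (\<Prod>c\<in>C. g c (restrict D (K c))) \<partial>PiM I (\<lambda>_. M))
    = (\<Prod>c\<in>C. \<integral>\<^sup>+D. g c (restrict D (K c)) \<partial>PiM I (\<lambda>_. M))"
proof -
  interpret I: prob_space "PiM I (\<lambda>_. M)" by (rule product_measure_prob_space)
  have "I.indep_vars (\<lambda>c. PiM (K c) (\<lambda>_. M)) (\<lambda>c D. restrict D (K c)) C"
    using I.indep_vars_restrict[OF indep_vars_coordinates K] by simp
  then have "I.indep_vars (\<lambda>_. borel) (\<lambda>c. g c \<circ> (\<lambda>D. restrict D (K c))) C"
    by (rule I.indep_vars_compose) (use g in auto)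
  then show ?thesis
    using I.indep_vars_nn_integral[OF assms(1), of "\<lambda>c. g c \<circ> (\<lambda>D. restrict D (K c))"] by simp
qed

text \<open>If at least half of the blocks fail, then the product over the blocks of \<open>16\<close> for a failure and \<open>1\<close>
  for a success is at least \<open>4\<^sup>B\<close>. Each factor has expectation at most \<open>2\<close> and the factors are independent,
  so Markov's inequality bounds the probability by \<open>2\<^sup>B / 4\<^sup>B\<close>.\<close>

lemma majority_of_blocks_le:
  fixes K :: "nat \<Rightarrow> nat set" and Q :: "nat \<Rightarrow> (nat \<Rightarrow> 'a) \<Rightarrow> bool"
  assumes K: "\<And>c. c < B \<Longrightarrow> K c \<subseteq> I" "disjoint_family_on K {..<B}"
    and Qm: "\<And>c. c < B \<Longrightarrow> {D \<in> space (PiM (K c) (\<lambda>_. M)). Q c D} \<in> sets (PiM (K c) (\<lambda>_. M))"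
    and Qr: "\<And>c D. Q c (restrict D (K c)) = Q c D"
    and q: "\<And>c. c < B \<Longrightarrow> measure (PiM I (\<lambda>_. M)) {D \<in> space (PiM I (\<lambda>_. M)). Q c D} \<le> 1 / 16"
  shows "measure (PiM I (\<lambda>_. M))
      {D \<in> space (PiM I (\<lambda>_. M)). B \<le> 2 * card {c. c < B \<and> Q c D}} \<le> (1 / 2) ^ B"
proof -
  interpret I: prob_space "PiM I (\<lambda>_. M)" by (rule product_measure_prob_space)
  define g :: "nat \<Rightarrow> (nat \<Rightarrow> 'a) \<Rightarrow> ennreal" where
    "g = (\<lambda>c D. if Q c D then 16 else 1)"
  have gm: "g c \<in> borel_measurable (PiM (K c) (\<lambda>_. M))" if "c < B" for c
    unfolding g_def using Qm[OF that] by (intro measurable_If) auto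
  have res: "(\<lambda>D. restrict D (K c)) \<in> PiM I (\<lambda>_. M) \<rightarrow>\<^sub>M PiM (K c) (\<lambda>_. M)" if "c < B" for c
    by (rule measurable_restrict_subset[OF K(1)[OF that]])
  have gr: "g c (restrict D (K c)) = g c D" for c D by (simp add: g_def Qr)
  have gmI [measurable]: "g c \<in> borel_measurable (PiM I (\<lambda>_. M))" if "c < B" for c
    using measurable_compose[OF res[OF that] gm[OF that]] by (simp add: gr)
  have Qs [measurable]: "{D \<in> space (PiM I (\<lambda>_. M)). Q c D} \<in> sets (PiM I (\<lambda>_. M))" if "c < B" for c
  proof -
    have "{D \<in> space (PiM I (\<lambda>_. M)). Q c D} = g c -` {16} \<inter> space (PiM I (\<lambda>_. M))"
      by (auto simp: g_def split: if_splits)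
    then show ?thesis using gmI[OF that] by (auto intro: measurable_sets)
  qed
  have g_le: "(\<integral>\<^sup>+D. g c D \<partial>PiM I (\<lambda>_. M)) \<le> 2" if c: "c < B" for c
  proof -
    let ?E = "{D \<in> space (PiM I (\<lambda>_. M)). Q c D}"
    have "(\<integral>\<^sup>+D. g c D \<partial>PiM I (\<lambda>_. M)) = (\<integral>\<^sup>+D. 1 + 15 * indicator ?E D \<partial>PiM I (\<lambda>_. M))"
      by (intro nn_integral_cong) (auto simp: g_def)
    also have "\<dots> = 1 + 15 * emeasure (PiM I (\<lambda>_. M)) ?E"
      using Qs[OF c] by (simp add: nn_integral_add nn_integral_cmult I.emeasure_space_1)
    also have "\<dots> \<le> 1 + 15 * ennreal (1 / 16)"
      using q[OF c] by (intro add_left_mono mult_left_mono) (auto simp: I.emeasure_eq_measure)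
    also have "\<dots> = ennreal (1 + 15 / 16)"
      by (simp add: ennreal_mult'[symmetric] ennreal_plus[symmetric] flip: ennreal_numeral ennreal_1 del: ennreal_plus)
    also have "\<dots> \<le> ennreal 2" by (intro ennreal_leI) simp
    finally show ?thesis by simp
  qed
  let ?E = "{D \<in> space (PiM I (\<lambda>_. M)). B \<le> 2 * card {c. c < B \<and> Q c D}}"
  have prod: "(\<Prod>c<B. g c D) = 16 ^ card {c. c < B \<and> Q c D}" for D
  proof -
    have "(\<Prod>c<B. g c D) = (\<Prod>c\<in>{c \<in> {..<B}. Q c D}. 16)"
      unfolding g_def by (subst prod.inter_filter) auto
    then show ?thesis by simp
  qed
  \<comment> \<open>Via the product, the counting event becomes a level set of a measurable function.\<close>
  have Es: "?E \<in> sets (PiM I (\<lambda>_. M))"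
  proof -
    have "?E = {D \<in> space (PiM I (\<lambda>_. M)). 4 ^ B \<le> (\<Prod>c<B. g c D)}"
    proof -
      have "B \<le> 2 * k \<longleftrightarrow> (4::ennreal) ^ B \<le> 16 ^ k" for k
      proof -
        have "(16::ennreal) ^ k = 4 ^ (2 * k)" by (simp add: power_mult power2_eq_square)
        then show ?thesis by (metis ennreal_numeral ennreal_power ennreal_le_iff
           power_increasing_iff one_less_numeral_iff semiring_norm(76) zero_le_numeral zero_le_power)
      qed
      then show ?thesis by (simp add: prod)
    qed
    then show ?thesis by (simp, measurable)
  qed
  have "emeasure (PiM I (\<lambda>_. M)) ?E = (\<integral>\<^sup>+D. indicator ?E D \<partial>PiM I (\<lambda>_. M))"
    using Es by simp
  also have "\<dots> \<le> (\<integral>\<^sup>+D. ennreal ((1 / 4) ^ B) * (\<Prod>c<B. g c D) \<partial>PiM I (\<lambda>_. M))"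
  proof (rule nn_integral_mono)
    fix D
    show "indicator ?E D \<le> ennreal ((1 / 4) ^ B) * (\<Prod>c<B. g c D)"
    proof (cases "D \<in> ?E")
      case True
      let ?k = "card {c. c < B \<and> Q c D}"
      have "(4::real) ^ B \<le> 4 ^ (2 * ?k)" using True by (intro power_increasing) auto
      then have "1 \<le> (1 / 4) ^ B * (16::real) ^ ?k"
        by (simp add: power_mult field_simps)
      then have "ennreal 1 \<le> ennreal ((1 / 4) ^ B * (16::real) ^ ?k)" by (rule ennreal_leI)
      then show ?thesis using True by (simp add: prod ennreal_mult flip: ennreal_power)
    qed auto
  qed
  also have "\<dots> = ennreal ((1 / 4) ^ B) * (\<integral>\<^sup>+D. (\<Prod>c<B. g c (restrict D (K c))) \<partial>PiM I (\<lambda>_. M))"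
    unfolding gr by (rule nn_integral_cmult) measurable
  also have "\<dots> = ennreal ((1 / 4) ^ B) * (\<Prod>c<B. \<integral>\<^sup>+D. g c (restrict D (K c)) \<partial>PiM I (\<lambda>_. M))"
    by (subst nn_integral_prod_blocks) (use K gm in auto)
  also have "\<dots> \<le> ennreal ((1 / 4) ^ B) * (\<Prod>c<B. 2)"
    unfolding gr by (intro mult_left_mono prod_mono_ennreal g_le) auto
  also have "\<dots> = ennreal ((1 / 2) ^ B)"
  proof -
    have "(2::ennreal) ^ B = ennreal (2 ^ B)" by (simp flip: ennreal_power)
    then show ?thesis by (simp add: ennreal_mult'[symmetric] flip: power_mult_distrib)
  qed
  finally show ?thesis by (simp add: I.emeasure_eq_measure)
qed

lemma integral_coordinate:
  fixes X :: "'a \<Rightarrow> real"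
  assumes [measurable]: "X \<in> borel_measurable M" and "i \<in> I"
  shows "(\<integral>D. X (D i) \<partial>PiM I (\<lambda>_. M)) = expectation X"
    and "integrable (PiM I (\<lambda>_. M)) (\<lambda>D. X (D i)) = integrable M X"
proof -
  have d: "distr (PiM I (\<lambda>_. M)) M (\<lambda>D. D i) = M"
    by (rule distr_PiM_component[OF _ assms(2)]) (rule prob_space_axioms)
  have m: "(\<lambda>D. D i) \<in> PiM I (\<lambda>_. M) \<rightarrow>\<^sub>M M" using assms(2) by measurable
  show "(\<integral>D. X (D i) \<partial>PiM I (\<lambda>_. M)) = expectation X"
    using integral_distr[OF m assms(1)] by (simp add: d)
  show "integrable (PiM I (\<lambda>_. M)) (\<lambda>D. X (D i)) = integrable M X"
    using integrable_distr_eq[OF m assms(1)] by (simp add: d)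
qed

text \<open>The mixed terms vanish by independence and centring.\<close>

lemma second_moment_sum:
  fixes X :: "'a \<Rightarrow> real"
  assumes "finite I" and "J \<subseteq> I" and [measurable]: "X \<in> borel_measurable M"
    and int: "integrable M X" "integrable M (\<lambda>x. (X x)\<^sup>2)" and zero: "expectation X = 0"
  shows "integrable (PiM I (\<lambda>_. M)) (\<lambda>D. (\<Sum>i\<in>J. X (D i))\<^sup>2)"
    and "(\<integral>D. (\<Sum>i\<in>J. X (D i))\<^sup>2 \<partial>PiM I (\<lambda>_. M)) = real (card J) * expectation (\<lambda>x. (X x)\<^sup>2)"
proof -
  interpret I: prob_space "PiM I (\<lambda>_. M)" by (rule product_measure_prob_space)
  have J: "finite J" using assms(1,2) by (rule rev_finite_subset)
  have cross: "integrable (PiM I (\<lambda>_. M)) (\<lambda>D. X (D i) * X (D j)) \<and>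
      (\<integral>D. X (D i) * X (D j) \<partial>PiM I (\<lambda>_. M)) = (if i = j then expectation (\<lambda>x. (X x)\<^sup>2) else 0)"
    if ij: "i \<in> J" "j \<in> J" for i j
  proof (cases "i = j")
    case True
    then show ?thesis
      using integral_coordinate[of "\<lambda>x. (X x)\<^sup>2" j I] ij assms(2) int(2)
      by (auto simp: power2_eq_square)
  next
    case False
    have sub: "{i, j} \<subseteq> I" using ij assms(2) by auto
    have "I.indep_vars (\<lambda>_. M) (\<lambda>i D. D i) {i, j}"
      using indep_vars_coordinates sub by (rule I.indep_vars_subset)
    then have ind: "I.indep_vars (\<lambda>_. borel) (\<lambda>i. X \<circ> (\<lambda>D. D i)) {i, j}"
      by (rule I.indep_vars_compose) auto
    have int': "integrable (PiM I (\<lambda>_. M)) (X \<circ> (\<lambda>D. D k))" if "k \<in> {i, j}" for k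
      using integral_coordinate(2)[of X k I] int(1) that sub by (auto simp: comp_def)
    show ?thesis
      using I.indep_vars_lebesgue_integral[OF _ ind int'] I.indep_vars_integrable[OF _ ind int']
        False integral_coordinate(1)[of X i I] sub zero
      by (auto simp: comp_def)
  qed
  have sq: "(\<Sum>i\<in>J. X (D i))\<^sup>2 = (\<Sum>i\<in>J. \<Sum>j\<in>J. X (D i) * X (D j))" for D
    by (simp add: power2_eq_square sum_product)
  show "integrable (PiM I (\<lambda>_. M)) (\<lambda>D. (\<Sum>i\<in>J. X (D i))\<^sup>2)"
    unfolding sq using cross by (intro Bochner_Integration.integrable_sum) auto
  have "(\<integral>D. (\<Sum>i\<in>J. X (D i))\<^sup>2 \<partial>PiM I (\<lambda>_. M))
      = (\<Sum>i\<in>J. \<Sum>j\<in>J. \<integral>D. X (D i) * X (D j) \<partial>PiM I (\<lambda>_. M))"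
  proof -
    have inner: "integrable (PiM I (\<lambda>_. M)) (\<lambda>D. \<Sum>j\<in>J. X (D i) * X (D j))" if "i \<in> J" for i
      using cross[OF that] by (intro Bochner_Integration.integrable_sum) auto
    have "(\<integral>D. (\<Sum>j\<in>J. X (D i) * X (D j)) \<partial>PiM I (\<lambda>_. M))
        = (\<Sum>j\<in>J. \<integral>D. X (D i) * X (D j) \<partial>PiM I (\<lambda>_. M))" if "i \<in> J" for i
      using cross[OF that] by (intro Bochner_Integration.integral_sum) auto
    then show ?thesis
      unfolding sq by (subst Bochner_Integration.integral_sum[OF inner]) auto
  qed
  also have "\<dots> = (\<Sum>i\<in>J. \<Sum>j\<in>J. if i = j then expectation (\<lambda>x. (X x)\<^sup>2) else 0)"
    using cross by (intro sum.cong refl) auto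
  finally show "(\<integral>D. (\<Sum>i\<in>J. X (D i))\<^sup>2 \<partial>PiM I (\<lambda>_. M)) = real (card J) * expectation (\<lambda>x. (X x)\<^sup>2)"
    using J by simp
qed

lemma mean_chebyshev:
  fixes X :: "'a \<Rightarrow> real"
  assumes "finite I" and J: "J \<subseteq> I" "J \<noteq> {}" and [measurable]: "X \<in> borel_measurable M"
    and int: "integrable M X" "integrable M (\<lambda>x. (X x)\<^sup>2)" and s: "0 < s"
  shows "measure (PiM I (\<lambda>_. M)) {D \<in> space (PiM I (\<lambda>_. M)).
      s < \<bar>(\<Sum>i\<in>J. X (D i)) / real (card J) - expectation X\<bar>}
    \<le> expectation (\<lambda>x. (X x)\<^sup>2) / (real (card J) * s\<^sup>2)"
proof -
  interpret I: prob_space "PiM I (\<lambda>_. M)" by (rule product_measure_prob_space)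
  define m where "m = real (card J)"
  have m: "m > 0" using assms(1) J by (auto simp: m_def card_gt_0_iff intro: finite_subset)
  define Y where "Y = (\<lambda>x. X x - expectation X)"
  have [measurable]: "Y \<in> borel_measurable M" unfolding Y_def by measurable
  have Y: "integrable M Y" "expectation Y = 0"
    using int by (auto simp: Y_def prob_space)
  have Y2: "integrable M (\<lambda>x. (Y x)\<^sup>2)" "expectation (\<lambda>x. (Y x)\<^sup>2) \<le> expectation (\<lambda>x. (X x)\<^sup>2)"
  proof -
    show "integrable M (\<lambda>x. (Y x)\<^sup>2)"
      unfolding Y_def power2_diff using int by auto
    show "expectation (\<lambda>x. (Y x)\<^sup>2) \<le> expectation (\<lambda>x. (X x)\<^sup>2)"
      unfolding Y_def using variance_eq[OF int] by simp
  qed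
  have Jsub: "\<And>i. i \<in> J \<Longrightarrow> i \<in> I" using J by auto
  have Xm[measurable]: "(\<lambda>D. \<Sum>i\<in>J. X (D i)) \<in> borel_measurable (PiM I (\<lambda>_. M))"
    using Jsub by measurable
  have sumY: "(\<Sum>i\<in>J. Y (D i)) = m * ((\<Sum>i\<in>J. X (D i)) / m - expectation X)" for D
    using m by (simp add: Y_def sum_subtractf m_def field_simps)
  have "measure (PiM I (\<lambda>_. M)) {D \<in> space (PiM I (\<lambda>_. M)). s < \<bar>(\<Sum>i\<in>J. X (D i)) / m - expectation X\<bar>}
      \<le> measure (PiM I (\<lambda>_. M)) {D \<in> space (PiM I (\<lambda>_. M)). (m * s)\<^sup>2 \<le> (\<Sum>i\<in>J. Y (D i))\<^sup>2}"
  proof (rule I.finite_measure_mono)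
    show "{D \<in> space (PiM I (\<lambda>_. M)). (m * s)\<^sup>2 \<le> (\<Sum>i\<in>J. Y (D i))\<^sup>2} \<in> sets (PiM I (\<lambda>_. M))"
      unfolding sumY by measurable
    have "(m * s)\<^sup>2 \<le> (m * d)\<^sup>2" if "s < \<bar>d\<bar>" for d
      using that m s by (simp add: power_mult_distrib flip: abs_le_square_iff)
    then show "{D \<in> space (PiM I (\<lambda>_. M)). s < \<bar>(\<Sum>i\<in>J. X (D i)) / m - expectation X\<bar>}
      \<subseteq> {D \<in> space (PiM I (\<lambda>_. M)). (m * s)\<^sup>2 \<le> (\<Sum>i\<in>J. Y (D i))\<^sup>2}"
      unfolding sumY by auto
  qed
  also have "\<dots> \<le> (\<integral>D. (\<Sum>i\<in>J. Y (D i))\<^sup>2 \<partial>PiM I (\<lambda>_. M)) / (m * s)\<^sup>2"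
    by (rule integral_Markov_inequality_measure[where A="{}"])
       (use m s second_moment_sum[OF assms(1) J(1) _ Y(1) Y2(1) Y(2)] in auto)
  also have "\<dots> = expectation (\<lambda>x. (Y x)\<^sup>2) / (m * s\<^sup>2)"
    using m second_moment_sum(2)[OF assms(1) J(1) _ Y(1) Y2(1) Y(2)]
    by (simp add: m_def power2_eq_square)
  also have "\<dots> \<le> expectation (\<lambda>x. (X x)\<^sup>2) / (m * s\<^sup>2)"
    by (intro divide_right_mono Y2) (use m in auto)
  finally show ?thesis by (simp add: m_def)
qed

end

section \<open>Medians\<close>

lemma sorted_suffix_above:
  assumes "sorted xs" "i < length xs" "u < xs ! i"
  shows "length xs - i \<le> length (filter (\<lambda>x. u < (x::real)) xs)"
proof -
  have "filter (\<lambda>x. u < x) (drop i xs) = drop i xs"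
  proof (rule filter_True, rule ballI)
    fix x assume "x \<in> set (drop i xs)"
    then obtain j where j: "j < length xs - i" "x = xs ! (i + j)"
      using assms(2) by (auto simp: in_set_conv_nth)
    then have "xs ! i \<le> xs ! (i + j)" by (intro sorted_nth_mono[OF assms(1)]) auto
    then show "u < x" using assms(3) j(2) by simp
  qed
  then have "length (filter (\<lambda>x. u < x) (drop i xs)) = length xs - i" by simp
  moreover have "length (filter (\<lambda>x. u < x) xs)
      = length (filter (\<lambda>x. u < x) (take i xs)) + length (filter (\<lambda>x. u < x) (drop i xs))"
    by (metis append_take_drop_id filter_append length_append)
  ultimately show ?thesis by simp
qed

lemma sorted_prefix_below:
  assumes "sorted xs" "i < length xs" "xs ! i < l"
  shows "Suc i \<le> length (filter (\<lambda>x. (x::real) < l) xs)"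
proof -
  have "filter (\<lambda>x. x < l) (take (Suc i) xs) = take (Suc i) xs"
  proof (rule filter_True, rule ballI)
    fix x assume "x \<in> set (take (Suc i) xs)"
    then obtain j where "j < Suc i" "x = xs ! j"
      using assms(2) by (auto simp: in_set_conv_nth)
    then show "x < l" using sorted_nth_mono[OF assms(1), of j i] assms by auto
  qed
  then have "length (filter (\<lambda>x. x < l) (take (Suc i) xs)) = Suc i" using assms(2) by simp
  moreover have "length (filter (\<lambda>x. x < l) xs)
      = length (filter (\<lambda>x. x < l) (take (Suc i) xs)) + length (filter (\<lambda>x. x < l) (drop (Suc i) xs))"
    by (metis append_take_drop_id filter_append length_append)
  ultimately show ?thesis by simp
qed

text \<open>If the upper of the two middle order statistics were too large, half of the entries would be.
  Likewise for the lower one.\<close>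

lemma median_within:
  assumes "xs \<noteq> []"
    and less: "2 * length (filter (\<lambda>x. r < \<bar>x - m\<bar>) xs) < length xs"
  shows "\<bar>median xs - m\<bar> \<le> r"
proof -
  define ys where "ys = sort xs"
  define n where "n = length xs"
  have ys: "sorted ys" "length ys = n" by (auto simp: ys_def n_def)
  have n: "n > 0" using assms(1) by (simp add: n_def)
  have bad: "2 * length (filter P ys) < n" if "\<And>x. P x \<Longrightarrow> r < \<bar>x - m\<bar>" for P
  proof -
    have "length (filter P ys) = size (filter_mset P (mset ys))" by (metis mset_filter size_mset)
    also have "\<dots> \<le> size (filter_mset (\<lambda>x. r < \<bar>x - m\<bar>) (mset ys))"
      using that by (intro size_mset_mono filter_mset_mono_strong) auto
    also have "\<dots> = length (filter (\<lambda>x. r < \<bar>x - m\<bar>) xs)" by (metis ys_def mset_filter size_mset mset_sort)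
    finally show ?thesis using less by (simp add: n_def)
  qed
  have up: "ys ! (n div 2) \<le> m + r"
  proof (rule ccontr)
    assume "\<not> ?thesis"
    then have "n - n div 2 \<le> length (filter (\<lambda>x. m + r < x) ys)"
      using sorted_suffix_above[OF ys(1), of "n div 2"] ys n by auto
    moreover have "2 * length (filter (\<lambda>x. m + r < x) ys) < n" by (rule bad) auto
    ultimately show False by linarith
  qed
  have lo: "m - r \<le> ys ! ((n - 1) div 2)"
  proof (rule ccontr)
    assume "\<not> ?thesis"
    then have "Suc ((n - 1) div 2) \<le> length (filter (\<lambda>x. x < m - r) ys)"
      using sorted_prefix_below[OF ys(1), of "(n - 1) div 2"] ys n by auto
    moreover have "2 * length (filter (\<lambda>x. x < m - r) ys) < n" by (rule bad) auto
    ultimately show False by linarith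
  qed
  have "ys ! ((n - 1) div 2) \<le> ys ! (n div 2)"
    using n ys by (intro sorted_nth_mono) auto
  with up lo have "m - r \<le> median xs" "median xs \<le> m + r"
    unfolding median_def ys_def[symmetric] n_def[symmetric] by auto
  then show ?thesis by linarith
qed

lemma median_map_within:
  assumes "B > 0" and "\<not> B \<le> 2 * card {c. c < B \<and> r < \<bar>g c - m\<bar>}"
  shows "\<bar>median (map g [0..<B]) - m\<bar> \<le> r"
proof (rule median_within)
  have "length (filter (\<lambda>x. r < \<bar>x - m\<bar>) (map g [0..<B])) = card {c. c < B \<and> r < \<bar>g c - m\<bar>}"
    by (simp add: filter_map length_filter_conv_card comp_def)
      (intro arg_cong[where f=card], auto)
  then show "2 * length (filter (\<lambda>x. r < \<bar>x - m\<bar>) (map g [0..<B])) < length (map g [0..<B])"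
    using assms(2) by simp
qed (use assms in simp)

section \<open>Minimisers of the risk profile and subsample sizes\<close>

text \<open>If no point were a minimiser, each point \<open>z\<close> would have a competitor \<open>y z\<close> with a smaller value, and
  by semicontinuity that competitor would beat a whole neighbourhood of \<open>z\<close>. Among the finitely many
  competitors that belong to a finite subcover, the best one would be beaten by another.\<close>

lemma lsc_attains_min:
  fixes g :: "ennreal \<Rightarrow> ennreal"
  assumes "closed S" "S \<noteq> {}" and lsc: "lower_semicontinuous_on S g"
  shows "\<exists>z\<in>S. \<forall>y\<in>S. g z \<le> g y"
proof (rule ccontr)
  assume no: "\<not> ?thesis"
  have "\<exists>U y. open U \<and> z \<in> U \<and> y \<in> S \<and> (\<forall>x\<in>U \<inter> S. g y < g x)" if z: "z \<in> S" for z
  proof -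
    obtain y where y: "y \<in> S" "g y < g z" using no z by (auto simp: not_le)
    have "g z \<le> Liminf (at z within S) g" using lsc z by (simp add: lower_semicontinuous_on_def)
    then have "\<forall>\<^sub>F x in at z within S. g y < g x" using y(2) by (simp add: le_Liminf_iff)
    then obtain U where "open U" "z \<in> U" "\<forall>x\<in>U. x \<noteq> z \<longrightarrow> x \<in> S \<longrightarrow> g y < g x"
      by (auto simp: eventually_at_topological)
    then show ?thesis using y by (intro exI[of _ U] exI[of _ y]) auto
  qed
  then obtain U y where U: "\<And>z. z \<in> S \<Longrightarrow> open (U z) \<and> z \<in> U z \<and> y z \<in> S \<and> (\<forall>x\<in>U z \<inter> S. g (y z) < g x)"
    by metis
  have "compact S"
    using closed_Int_compact[OF assms(1) compact_UNIV] by simp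
  then obtain C where C: "C \<subseteq> S" "finite C" "S \<subseteq> (\<Union>z\<in>C. U z)"
    using compactE_image[of S S U] U by blast
  have "C \<noteq> {}" using C assms(2) by auto
  then obtain c where c: "c \<in> C" "\<And>z. z \<in> C \<Longrightarrow> g (y c) \<le> g (y z)"
    using ex_min_if_finite[of "(g \<circ> y) ` C"] C(2) by (fastforce simp: not_less)
  have "y c \<in> S" using c C U by auto
  then obtain z where "z \<in> C" "y c \<in> U z" using C by auto
  then have "g (y z) < g (y c)" using U C \<open>y c \<in> S\<close> by blast
  then show False using c(2)[OF \<open>z \<in> C\<close>] by simp
qed

lemma minimizer_exists:
  assumes "proper_on {ennreal \<gamma>..} g" "lower_semicontinuous_on {ennreal \<gamma>..} g"
  obtains z where "z \<in> minimizers \<gamma> g" "ennreal \<gamma> \<le> z" "g z = (INF x\<in>{ennreal \<gamma>..}. g x)" "g z < \<infinity>"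
proof -
  obtain z where z: "z \<in> {ennreal \<gamma>..}" "\<And>y. y \<in> {ennreal \<gamma>..} \<Longrightarrow> g z \<le> g y"
    using lsc_attains_min[OF _ _ assms(2)] by auto
  obtain y where "y \<in> {ennreal \<gamma>..}" "g y < \<infinity>" using assms(1) by (auto simp: proper_on_def)
  then have "g z < \<infinity>" using z(2) le_less_trans by blast
  moreover have "g z = (INF x\<in>{ennreal \<gamma>..}. g x)"
    using z by (intro antisym INF_greatest INF_lower) auto
  moreover have "z \<in> minimizers \<gamma> g"
    using z by (auto simp: minimizers_def is_arg_min_def not_less)
  ultimately show ?thesis using that z(1) by auto
qed

text \<open>The subsample size decreases from about \<open>n\<close> to at most twice the step as \<open>\<xi>\<close> runs through the grid, in
  steps of \<open>o(n)\<close>, so every limit \<open>\<rho>\<close> of the ratio of size to \<open>n\<close> can be approached. The size never drops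
  below the step, which forces it to infinity even if \<open>\<rho> = 0\<close>.\<close>

lemma grid_point_with_ratio:
  assumes \<nu>: "0 < \<nu>" "\<nu> < 1" and nte: "\<forall>\<^sub>F n in sequentially. 0 < nte n \<and> nte n < n"
    and lim: "(\<lambda>n. real (nte n) / real n) \<longlonglongrightarrow> 0"
    and \<rho>: "0 \<le> \<rho>" "\<rho> \<le> 1"
  obtains \<xi> where "\<forall>\<^sub>F n in sequentially. \<xi> n \<in> grid \<nu> n (nte n)"
    and "filterlim (\<lambda>n. sub_size \<nu> n (nte n) (\<xi> n)) at_top sequentially"
    and "(\<lambda>n. real (sub_size \<nu> n (nte n) (\<xi> n)) / real n) \<longlonglongrightarrow> \<rho>"
proof -
  define s where "s = (\<lambda>n. real (step \<nu> n))"
  define N where "N = (\<lambda>n. real n - real (nte n))"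
  define m where "m = (\<lambda>n. nat \<lceil>real (n - nte n) / s n - 2\<rceil>)"
  \<comment> \<open>Rounding up the real solution of \<open>N - \<xi> s = \<rho> n\<close> and truncating to the grid; a negative solution,
    possible for \<open>\<rho> = 1\<close>, is sent to the first grid point.\<close>
  define \<xi> where "\<xi> = (\<lambda>n. min (m n) (nat \<lfloor>(N n - \<rho> * real n) / s n\<rfloor> + 1))"
  have s_eq: "s n = of_int \<lfloor>real n powr \<nu>\<rfloor>" for n by (simp add: s_def step_def)
  have powr_top: "filterlim (\<lambda>n. real n powr \<nu>) at_top sequentially"
  proof (rule filterlim_at_top_mono)
    show "filterlim (\<lambda>n. exp (\<nu> * ln (real n))) at_top sequentially"
      by (intro filterlim_compose[OF exp_at_top] filterlim_tendsto_pos_mult_at_top[OF tendsto_const \<nu>(1)]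
          filterlim_compose[OF ln_at_top] filterlim_real_sequentially)
    show "\<forall>\<^sub>F n in sequentially. exp (\<nu> * ln (real n)) \<le> real n powr \<nu>"
      using eventually_gt_at_top[of 0] by eventually_elim (simp add: powr_def)
  qed
  have s_top: "filterlim s at_top sequentially"
  proof (rule filterlim_at_top_mono)
    show "filterlim (\<lambda>n. - 1 + real n powr \<nu>) at_top sequentially"
      by (rule filterlim_tendsto_add_at_top[OF tendsto_const powr_top])
    show "\<forall>\<^sub>F n in sequentially. - 1 + real n powr \<nu> \<le> s n"
      by (intro always_eventually allI) (unfold s_eq, linarith)
  qed
  have s_n: "(\<lambda>n. s n / real n) \<longlonglongrightarrow> 0"
  proof (rule tendsto_sandwich[OF _ _ tendsto_const])
    show "(\<lambda>n. real n powr (\<nu> - 1)) \<longlonglongrightarrow> 0"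
      using tendsto_neg_powr[OF _ filterlim_real_sequentially, of "\<nu> - 1"] \<nu> by simp
    show "\<forall>\<^sub>F n in sequentially. 0 \<le> s n / real n" by (simp add: s_def)
    show "\<forall>\<^sub>F n in sequentially. s n / real n \<le> real n powr (\<nu> - 1)"
      using eventually_gt_at_top[of 0]
    proof eventually_elim
      case (elim n)
      have "s n \<le> real n powr \<nu>" unfolding s_eq by linarith
      then show ?case using elim by (simp add: powr_diff divide_right_mono)
    qed
  qed
  have s1: "\<forall>\<^sub>F n in sequentially. 1 \<le> s n"
    using s_top by (auto simp: filterlim_at_top)
  have N_n: "(\<lambda>n. N n / real n) \<longlonglongrightarrow> 1"
  proof -
    have "(\<lambda>n. 1 - real (nte n) / real n) \<longlonglongrightarrow> 1 - 0" by (intro tendsto_intros lim)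
    moreover have "\<forall>\<^sub>F n in sequentially. 1 - real (nte n) / real n = N n / real n"
      using eventually_gt_at_top[of 0] by eventually_elim (simp add: N_def diff_divide_distrib)
    ultimately show ?thesis by (auto elim: Lim_transform_eventually)
  qed
  have mb: "\<forall>\<^sub>F n in sequentially. 1 \<le> m n \<and> N n - 2 * s n \<le> real (m n) * s n \<and> real (m n) * s n < N n - s n"
  proof -
    have "(\<lambda>n. N n / real n - 3 * (s n / real n)) \<longlonglongrightarrow> 1 - 3 * 0"
      by (intro tendsto_intros N_n s_n)
    then have "\<forall>\<^sub>F n in sequentially. 0 < N n / real n - 3 * (s n / real n)"
      by (rule order_tendstoD) simp
    then show ?thesis using nte s1 eventually_gt_at_top[of 0]
    proof eventually_elim
      case (elim n)
      define x where "x = N n / s n"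
      have Nx: "N n = x * s n" using elim by (simp add: x_def)
      have "3 * s n < N n" using elim by (simp add: field_simps)
      then have x3: "3 < x" using elim by (simp add: Nx)
      have "m n = nat \<lceil>x - 2\<rceil>" using elim by (simp add: m_def x_def N_def of_nat_diff)
      then have "real (m n) = of_int \<lceil>x - 2\<rceil>" using x3 by (simp add: of_nat_nat)
      then have mx: "x - 2 \<le> real (m n)" "real (m n) < x - 1"
        using ceiling_correct[of "x - 2"] by linarith+
      have "(x - 2) * s n \<le> real (m n) * s n" "real (m n) * s n < (x - 1) * s n"
        using mx elim by (auto intro!: mult_right_mono mult_strict_right_mono)
      moreover have "1 \<le> m n" using mx x3 by linarith
      ultimately show ?case by (simp add: Nx algebra_simps)
    qed
  qed
  have size: "\<forall>\<^sub>F n in sequentially. real (sub_size \<nu> n (nte n) (\<xi> n)) = N n - real (\<xi> n) * s n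
      \<and> s n \<le> N n - real (\<xi> n) * s n"
    using mb nte s1
  proof eventually_elim
    case (elim n)
    have "real (\<xi> n) * s n \<le> real (m n) * s n"
      using elim by (intro mult_right_mono) (auto simp: \<xi>_def)
    then have le: "s n \<le> N n - real (\<xi> n) * s n" using elim by linarith
    then have "real (\<xi> n * step \<nu> n) \<le> real (n - nte n)"
      using elim by (simp add: s_def N_def of_nat_diff)
    then have "\<xi> n * step \<nu> n \<le> n - nte n" by (simp only: of_nat_le_iff)
    then show ?case using le elim
      by (simp add: sub_size_def N_def s_def of_nat_diff del: diff_diff_left)
  qed
  show thesis
  proof (rule that)
    show "\<forall>\<^sub>F n in sequentially. \<xi> n \<in> grid \<nu> n (nte n)"
      using mb by eventually_elim (auto simp: grid_def \<xi>_def m_def s_def)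
    show "filterlim (\<lambda>n. sub_size \<nu> n (nte n) (\<xi> n)) at_top sequentially"
    proof -
      have "filterlim (\<lambda>n. real (sub_size \<nu> n (nte n) (\<xi> n))) at_top sequentially"
        by (rule filterlim_at_top_mono[OF s_top]) (use size in eventually_elim, auto)
      then show ?thesis by (simp add: filterlim_sequentially_iff_filterlim_real)
    qed
    have lo: "(\<lambda>n. min (N n / real n - 2 * (s n / real n)) (N n / real n - \<rho>)) \<longlonglongrightarrow> min (1 - 2 * 0) (1 - \<rho>)"
      by (intro tendsto_intros N_n s_n)
    have hi: "(\<lambda>n. max 0 (N n / real n - \<rho>) + s n / real n) \<longlonglongrightarrow> max 0 (1 - \<rho>) + 0"
      by (intro tendsto_intros N_n s_n)
    have "(\<lambda>n. real (\<xi> n) * s n / real n) \<longlonglongrightarrow> 1 - \<rho>"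
    proof (rule tendsto_sandwich)
      show "(\<lambda>n. min (N n / real n - 2 * (s n / real n)) (N n / real n - \<rho>)) \<longlonglongrightarrow> 1 - \<rho>"
        using lo \<rho> by simp
      show "(\<lambda>n. max 0 (N n / real n - \<rho>) + s n / real n) \<longlonglongrightarrow> 1 - \<rho>"
        using hi \<rho> by simp
      show "\<forall>\<^sub>F n in sequentially. min (N n / real n - 2 * (s n / real n)) (N n / real n - \<rho>)
          \<le> real (\<xi> n) * s n / real n"
        using mb s1 eventually_gt_at_top[of 0]
      proof eventually_elim
        case (elim n)
        define x where "x = (N n - \<rho> * real n) / s n"
        have "x \<le> real (nat \<lfloor>x\<rfloor> + 1)" by linarith
        then have "x * s n \<le> real (nat \<lfloor>x\<rfloor> + 1) * s n" using elim by (intro mult_right_mono) auto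
        moreover have "x * s n = N n - \<rho> * real n" using elim by (simp add: x_def)
        ultimately have "min (N n - 2 * s n) (N n - \<rho> * real n) \<le> real (\<xi> n) * s n"
          using elim unfolding \<xi>_def x_def[symmetric] min_def by auto
        then have "min (N n - 2 * s n) (N n - \<rho> * real n) / real n \<le> real (\<xi> n) * s n / real n"
          by (rule divide_right_mono) simp
        then show ?case using elim by (simp add: min_divide_distrib_right diff_divide_distrib)
      qed
      show "\<forall>\<^sub>F n in sequentially. real (\<xi> n) * s n / real n \<le> max 0 (N n / real n - \<rho>) + s n / real n"
        using s1 eventually_gt_at_top[of 0]
      proof eventually_elim
        case (elim n)
        define x where "x = (N n - \<rho> * real n) / s n"
        have "real (\<xi> n) \<le> real (nat \<lfloor>x\<rfloor> + 1)" by (simp add: \<xi>_def x_def)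
        also have "\<dots> \<le> max 0 x + 1" by linarith
        finally have "real (\<xi> n) * s n \<le> (max 0 x + 1) * s n" using elim by (intro mult_right_mono) auto
        also have "\<dots> = max 0 (x * s n) + s n" using elim by (simp add: max_mult_distrib_right distrib_right)
        also have "x * s n = N n - \<rho> * real n" using elim by (simp add: x_def)
        finally have "real (\<xi> n) * s n / real n \<le> (max 0 (N n - \<rho> * real n) + s n) / real n"
          by (rule divide_right_mono) simp
        then show ?case using elim by (simp add: add_divide_distrib max_divide_distrib_right diff_divide_distrib)
      qed
    qed
    then have "(\<lambda>n. N n / real n - real (\<xi> n) * s n / real n) \<longlonglongrightarrow> 1 - (1 - \<rho>)"
      by (intro tendsto_intros N_n)
    moreover have "\<forall>\<^sub>F n in sequentially. N n / real n - real (\<xi> n) * s n / real n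
        = real (sub_size \<nu> n (nte n) (\<xi> n)) / real n"
      using size by eventually_elim (simp add: diff_divide_distrib)
    ultimately show "(\<lambda>n. real (sub_size \<nu> n (nte n) (\<xi> n)) / real n) \<longlonglongrightarrow> \<rho>"
      by (auto elim: Lim_transform_eventually)
  qed
qed

lemma finite_grid: "finite (grid \<nu> n m)"
  by (simp add: grid_def)

lemma card_grid_le: "card (grid \<nu> n m) \<le> n"
proof -
  have "real (n - m) / real (step \<nu> n) \<le> real (n - m)"
    by (cases "step \<nu> n = 0") (auto simp: divide_le_eq mult_le_cancel_left1)
  also have "\<dots> \<le> real n" by simp
  finally have "\<lceil>real (n - m) / real (step \<nu> n) - 2\<rceil> \<le> int n" by linarith
  then show ?thesis by (simp add: grid_def nat_le_iff)
qed

text \<open>The ratio of subsample size to \<open>n\<close> has to tend to \<open>\<gamma> / z\<close>, which lies in \<open>[0, 1]\<close> and is \<open>0\<close> for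
  \<open>z = \<infinity>\<close>.\<close>

lemma reference_subsample_sizes:
  assumes \<gamma>: "\<gamma> > 0" and pn: "(\<lambda>n. real (p n) / real n) \<longlonglongrightarrow> \<gamma>" and z: "ennreal \<gamma> \<le> z"
    and \<nu>: "0 < \<nu>" "\<nu> < 1" and nte: "\<forall>\<^sub>F n in sequentially. 0 < nte n \<and> nte n < n"
    and lim: "(\<lambda>n. real (nte n) / real n) \<longlonglongrightarrow> 0"
  obtains \<xi> where "\<forall>\<^sub>F n in sequentially. \<xi> n \<in> grid \<nu> n (nte n)"
    and "proportional p (\<lambda>n. n) (\<lambda>n. sub_size \<nu> n (nte n) (\<xi> n)) z"
proof -
  define \<rho> where "\<rho> = (if z = \<infinity> then 0 else \<gamma> / enn2real z)"
  have zr: "z = ennreal (enn2real z)" "\<gamma> \<le> enn2real z" if "z \<noteq> \<infinity>"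
  proof -
    show *: "z = ennreal (enn2real z)" using that by (simp add: less_top)
    show "\<gamma> \<le> enn2real z" using z \<gamma> by (subst (asm) *) (simp add: ennreal_le_iff2)
  qed
  have \<rho>: "0 \<le> \<rho>" "\<rho> \<le> 1" using zr(2) \<gamma> by (auto simp: \<rho>_def divide_le_eq)
  obtain \<xi> where \<xi>: "\<forall>\<^sub>F n in sequentially. \<xi> n \<in> grid \<nu> n (nte n)"
    and top: "filterlim (\<lambda>n. sub_size \<nu> n (nte n) (\<xi> n)) at_top sequentially"
    and ratio: "(\<lambda>n. real (sub_size \<nu> n (nte n) (\<xi> n)) / real n) \<longlonglongrightarrow> \<rho>"
    by (rule grid_point_with_ratio[OF \<nu> nte lim \<rho>])
  let ?k = "\<lambda>n. sub_size \<nu> n (nte n) (\<xi> n)"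
  have k_pos: "\<forall>\<^sub>F n in sequentially. 0 < ?k n"
    using top eventually_gt_at_top[of 0] by (auto simp: filterlim_iff)
  have p_top: "filterlim p at_top sequentially"
  proof -
    have "filterlim (\<lambda>n. real (p n) / real n * real n) at_top sequentially"
      by (rule filterlim_tendsto_pos_mult_at_top[OF pn \<gamma> filterlim_real_sequentially])
    then have "filterlim (\<lambda>n. real (p n)) at_top sequentially"
      by (rule filterlim_at_top_mono) (use eventually_gt_at_top[of 0] in eventually_elim, simp)
    then show ?thesis by (simp add: filterlim_sequentially_iff_filterlim_real)
  qed
  have eq: "\<forall>\<^sub>F n in sequentially. (real (p n) / real n) / (real (?k n) / real n) = real (p n) / real (?k n)"
    using eventually_gt_at_top[of 0] by eventually_elim simp
  have "(\<lambda>n. ennreal (real (p n) / real (?k n))) \<longlonglongrightarrow> z"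
  proof (cases "z = \<infinity>")
    case True
    have "filterlim (\<lambda>n. (real (p n) / real n) / (real (?k n) / real n)) at_top sequentially"
    proof (rule LIM_at_top_divide)
      show "(\<lambda>n. real (p n) / real n) \<longlonglongrightarrow> \<gamma>" by (rule pn)
      show "(\<lambda>n. real (?k n) / real n) \<longlonglongrightarrow> 0" using ratio True by (simp add: \<rho>_def)
      show "\<forall>\<^sub>F n in sequentially. 0 < real (?k n) / real n"
        using k_pos eventually_gt_at_top[of 0] by eventually_elim simp
    qed (rule \<gamma>)
    then have "filterlim (\<lambda>n. real (p n) / real (?k n)) at_top sequentially"
      using filterlim_cong[OF refl refl eq] by simp
    then show ?thesis using True by (simp add: ennreal_tendsto_top_eq_at_top)
  next
    case False
    have "(\<lambda>n. (real (p n) / real n) / (real (?k n) / real n)) \<longlonglongrightarrow> \<gamma> / \<rho>"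
      by (intro tendsto_divide pn ratio) (use False \<gamma> zr in \<open>auto simp: \<rho>_def\<close>)
    also have "\<gamma> / \<rho> = enn2real z" using False \<gamma> zr by (auto simp: \<rho>_def)
    finally have "(\<lambda>n. real (p n) / real (?k n)) \<longlonglongrightarrow> enn2real z"
      by (rule Lim_transform_eventually[OF _ eq])
    then have "(\<lambda>n. ennreal (real (p n) / real (?k n))) \<longlonglongrightarrow> ennreal (enn2real z)"
      by (rule tendsto_ennrealI)
    then show ?thesis using zr(1)[OF False] by simp
  qed
  then show thesis
    using that \<xi> top p_top by (simp add: proportional_def)
qed

section \<open>Predictors as measurable functions of the data\<close>

text \<open>A dataset selected from a long sample is the full dataset of a relabelled shorter sample. This is how
  measurability and distribution of procedures are transferred to subsamples.\<close>

lemma dataset_reindex: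
  assumes "finite J"
  shows "dataset D J = dataset (\<lambda>i\<in>{..<card J}. D (sorted_list_of_set J ! i)) {..<card J}"
proof -
  let ?L = "sorted_list_of_set J"
  have "map D ?L = map (\<lambda>i. D (?L ! i)) [0..<card J]"
    by (rule nth_equalityI) simp_all
  moreover have "sorted_list_of_set {..<card J} = [0..<card J]"
    by (metis atLeast0LessThan sorted_list_of_set_range)
  ultimately show ?thesis by (simp add: dataset_def)
qed

lemma dataset_cong: "finite J \<Longrightarrow> (\<And>i. i \<in> J \<Longrightarrow> D i = D' i) \<Longrightarrow> dataset D J = dataset D' J"
  by (simp add: dataset_def)

lemma reindex_into:
  assumes "J \<subseteq> I" "finite J" "i < card J"
  shows "sorted_list_of_set J ! i \<in> I"
  using assms by (metis length_sorted_list_of_set nth_mem set_sorted_list_of_set subsetD)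

lemma measurable_reindex:
  assumes "J \<subseteq> I" "finite J"
  shows "(\<lambda>D. \<lambda>i\<in>{..<card J}. D (sorted_list_of_set J ! i))
    \<in> PiM I (\<lambda>_. N) \<rightarrow>\<^sub>M PiM {..<card J} (\<lambda>_. N)"
  by (intro measurable_restrict measurable_component_singleton reindex_into[OF assms]) auto

lemma measurable_procedure_dataset:
  assumes "measurable_procedure ft" and J: "J \<subseteq> I" "finite J"
  shows "(\<lambda>(D, x). ft p (dataset D J) x)
    \<in> borel_measurable (PiM I (\<lambda>_. obs_space p) \<Otimes>\<^sub>M feature_space p)"
proof -
  let ?r = "\<lambda>D. \<lambda>i\<in>{..<card J}. D (sorted_list_of_set J ! i)"
  have m: "(\<lambda>(D, x). ft p (dataset D {..<card J}) x)
      \<in> borel_measurable (PiM {..<card J} (\<lambda>_. obs_space p) \<Otimes>\<^sub>M feature_space p)"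
    using assms(1) by (simp add: measurable_procedure_def)
  have "(\<lambda>z. (?r (fst z), snd z)) \<in> PiM I (\<lambda>_. obs_space p) \<Otimes>\<^sub>M feature_space p
      \<rightarrow>\<^sub>M PiM {..<card J} (\<lambda>_. obs_space p) \<Otimes>\<^sub>M feature_space p"
    by (intro measurable_Pair measurable_compose[OF measurable_fst measurable_reindex[OF J]] measurable_snd)
  from measurable_compose[OF this m] show ?thesis
    by (simp add: case_prod_beta' dataset_reindex[OF J(2), symmetric])
qed

lemma measurable_average_predictor:
  assumes "measurable_procedure ft" and "\<And>j. j \<in> {1..M} \<Longrightarrow> s j \<subseteq> I \<and> finite (s j)"
  shows "(\<lambda>(D, x). average_predictor ft p M D s x)
    \<in> borel_measurable (PiM I (\<lambda>_. obs_space p) \<Otimes>\<^sub>M feature_space p)"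
  using measurable_procedure_dataset[OF assms(1), of "s _" I p] assms(2)
  unfolding average_predictor_def case_prod_beta'
  by (intro borel_measurable_divide borel_measurable_sum borel_measurable_const) auto

lemma average_predictor_cong:
  assumes "\<And>j. j \<in> {1..M} \<Longrightarrow> dataset D (s j) = dataset D' (s' j)"
  shows "average_predictor ft p M D s = average_predictor ft p M D' s'"
  unfolding average_predictor_def using assms by (intro ext arg_cong2[where f="(/)"] sum.cong) auto

locale loss_model = prob_space P for P :: "obs measure" +
  fixes p :: nat and l :: "real \<Rightarrow> real \<Rightarrow> real"
  assumes sets_P: "sets P = sets (obs_space p)"
    and l_nonneg: "0 \<le> l y z"
    and l_measurable: "(\<lambda>(y, z). l y z) \<in> borel_measurable (borel \<Otimes>\<^sub>M borel)"
begin

lemma fst_measurable: "fst \<in> P \<rightarrow>\<^sub>M feature_space p"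
  and snd_measurable: "snd \<in> borel_measurable P"
  unfolding measurable_cong_sets[OF sets_P refl] obs_space_def by auto

lemma sets_PiM_P: "sets (PiM I (\<lambda>_. P)) = sets (PiM I (\<lambda>_. obs_space p))"
  by (intro sets_PiM_cong refl sets_P)

lemma loss_measurable:
  assumes "f \<in> N \<rightarrow>\<^sub>M borel" "y \<in> N \<rightarrow>\<^sub>M borel"
  shows "(\<lambda>w. l (y w) (f w)) \<in> borel_measurable N"
  using measurable_compose[OF measurable_Pair[OF assms(2,1)] l_measurable] by simp

lemma loss_measurable_P:
  assumes "f \<in> borel_measurable (feature_space p)"
  shows "(\<lambda>(x, y). l y (f x)) \<in> borel_measurable P"
  using loss_measurable[OF measurable_compose[OF fst_measurable assms] snd_measurable]
  by (simp add: case_prod_beta')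

lemma family_loss_measurable:
  assumes "(\<lambda>(D, x). F D x) \<in> borel_measurable (N \<Otimes>\<^sub>M feature_space p)"
  shows "(\<lambda>z. l (snd (snd z)) (F (fst z) (fst (snd z)))) \<in> borel_measurable (N \<Otimes>\<^sub>M P)"
proof (rule loss_measurable)
  have "(\<lambda>z. (fst z, fst (snd z))) \<in> N \<Otimes>\<^sub>M P \<rightarrow>\<^sub>M N \<Otimes>\<^sub>M feature_space p"
    by (intro measurable_Pair measurable_fst measurable_compose[OF measurable_snd fst_measurable])
  from measurable_compose[OF this assms]
  show "(\<lambda>z. F (fst z) (fst (snd z))) \<in> borel_measurable (N \<Otimes>\<^sub>M P)" by simp
  show "(\<lambda>z. snd (snd z)) \<in> borel_measurable (N \<Otimes>\<^sub>M P)"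
    by (rule measurable_compose[OF measurable_snd snd_measurable])
qed

lemma measurable_section:
  assumes "(\<lambda>(D, x). F D x) \<in> borel_measurable (N \<Otimes>\<^sub>M feature_space p)" "D \<in> space N"
  shows "F D \<in> borel_measurable (feature_space p)"
  using measurable_compose[OF measurable_Pair1'[OF assms(2)] assms(1)] by simp

lemma risk_measurable:
  assumes "(\<lambda>(D, x). F D x) \<in> borel_measurable (N \<Otimes>\<^sub>M feature_space p)"
  shows "(\<lambda>D. risk l P (F D)) \<in> borel_measurable N"
  unfolding risk_def case_prod_beta'
  by (intro borel_measurable_nn_integral)
     (use family_loss_measurable[OF assms] in \<open>simp add: case_prod_beta'\<close>)

lemma dataset_risk_measurable:
  assumes ft: "measurable_procedure ft" and K: "K \<subseteq> {..<k}"
  shows "(\<lambda>D. risk l P (ft p (dataset D K))) \<in> borel_measurable (iid_law P k)"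
  unfolding iid_law_def
proof (rule risk_measurable)
  have "(\<lambda>(D, x). ft p (dataset D K) x) \<in> borel_measurable (PiM {..<k} (\<lambda>_. obs_space p) \<Otimes>\<^sub>M feature_space p)"
    by (rule measurable_procedure_dataset[OF ft K]) (rule finite_subset[OF K], simp)
  then show "(\<lambda>(D, x). ft p (dataset D K) x) \<in> borel_measurable (PiM {..<k} (\<lambda>_. P) \<Otimes>\<^sub>M feature_space p)"
    by (subst measurable_cong_sets[OF sets_pair_measure_cong[OF sets_PiM_P refl] refl])
qed

lemma loss_norm_Psi1_lessD:
  assumes "loss_norm Psi1 l P f < c"
  obtains C where "C > 0" "ennreal C < c" "(\<integral>\<^sup>+(x, y). ennreal (exp (\<bar>l y (f x)\<bar> / C)) \<partial>P) \<le> 2"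
  using assms by (auto simp: Inf_less_iff)

lemma exp_moment_mono:
  assumes "0 < C" "C \<le> C'" "(\<integral>\<^sup>+(x, y). ennreal (exp (\<bar>l y (f x)\<bar> / C)) \<partial>P) \<le> 2"
  shows "(\<integral>\<^sup>+(x, y). ennreal (exp (\<bar>l y (f x)\<bar> / C')) \<partial>P) \<le> 2"
proof (rule order_trans[OF nn_integral_mono assms(3)])
  show "(case z of (x, y) \<Rightarrow> ennreal (exp (\<bar>l y (f x)\<bar> / C')))
      \<le> (case z of (x, y) \<Rightarrow> ennreal (exp (\<bar>l y (f x)\<bar> / C)))" for z
    using assms(1,2) by (auto simp: case_prod_beta' intro!: ennreal_leI divide_left_mono)
qed

text \<open>The constants that are admissible in the \<open>\<psi>\<^sub>1\<close> norm form an up-closed set, so the infimum can be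
  tested on rational constants. Without measurability the hypotheses of stochastic boundedness would say
  nothing, since a nonmeasurable set has measure \<open>0\<close>.\<close>

lemma loss_norm_measurable:
  assumes F: "(\<lambda>(D, x). F D x) \<in> borel_measurable (N \<Otimes>\<^sub>M feature_space p)"
  shows "(\<lambda>D. loss_norm nk l P (F D)) \<in> borel_measurable N"
proof (cases nk)
  case Psi1
  let ?e = "\<lambda>C D. \<integral>\<^sup>+(x, y). ennreal (exp (\<bar>l y (F D x)\<bar> / C)) \<partial>P"
  have e: "?e C \<in> borel_measurable N" for C
    unfolding case_prod_beta'
    by (intro borel_measurable_nn_integral)
       (use family_loss_measurable[OF F] in \<open>simp add: case_prod_beta'\<close>)
  show ?thesis
  proof (rule borel_measurableI_less)
    fix c :: ennreal
    have "{D \<in> space N. loss_norm nk l P (F D) < c}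
        = (\<Union>C\<in>{C \<in> \<rat>. 0 < C \<and> ennreal C < c}. {D \<in> space N. ?e C D \<le> 2})" (is "?A = ?B")
    proof
      show "?A \<subseteq> ?B"
      proof
        fix D assume D: "D \<in> ?A"
        then have "loss_norm Psi1 l P (F D) < c" using Psi1 by simp
        then obtain C where C: "C > 0" "ennreal C < c" "?e C D \<le> 2"
          by (rule loss_norm_Psi1_lessD)
        \<comment> \<open>An intermediate \<open>d\<close> is finite even if \<open>c\<close> is not, which makes room for a rational.\<close>
        obtain d where d: "ennreal C < d" "d < c" using dense[OF C(2)] by blast
        then have "d < \<infinity>" using less_le_trans[OF d(2) top_greatest] by simp
        then have dr: "ennreal (enn2real d) = d" by simp
        then have "C < enn2real d" using d(1) C(1)
          by (metis ennreal_less_iff less_eq_real_def)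
        then obtain q where q: "q \<in> \<rat>" "C < q" "q < enn2real d" using Rats_dense_in_real by blast
        have "ennreal q \<le> d" using q dr by (metis ennreal_leI less_eq_real_def)
        moreover have "?e q D \<le> 2" using exp_moment_mono[of C q] q C by simp
        ultimately show "D \<in> ?B" using q C d D by (intro UN_I[of q]) auto
      qed
      show "?B \<subseteq> ?A"
      proof
        fix D assume "D \<in> ?B"
        then obtain C where "D \<in> space N" "0 < C" "ennreal C < c" "?e C D \<le> 2" by blast
        then show "D \<in> ?A" using Psi1 by (auto simp: Inf_less_iff)
      qed
    qed
    moreover have "?B \<in> sets N"
    proof (rule sets.countable_UN'')
      show "countable {C \<in> \<rat>. 0 < C \<and> ennreal C < c}"
        by (rule countable_subset[OF _ countable_rat]) auto
      show "{D \<in> space N. ?e C D \<le> 2} \<in> sets N" for C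
        using e[of C] by measurable
    qed
    ultimately show "{D \<in> space N. loss_norm nk l P (F D) < c} \<in> sets N" by simp
  qed
next
  case L2
  have [measurable]: "(\<lambda>D. \<integral>\<^sup>+(x, y). ennreal ((l y (F D x))\<^sup>2) \<partial>P) \<in> borel_measurable N"
    unfolding case_prod_beta'
    by (intro borel_measurable_nn_integral)
       (use family_loss_measurable[OF F] in \<open>simp add: case_prod_beta'\<close>)
  show ?thesis unfolding L2 loss_norm.simps Let_def by measurable
qed

lemma norm_ratio_measurable:
  assumes F: "(\<lambda>(D, x). F D x) \<in> borel_measurable (N \<Otimes>\<^sub>M feature_space p)"
  shows "(\<lambda>D. norm_ratio nk l P (F D)) \<in> borel_measurable N"
proof -
  note [measurable] = risk_measurable[OF F] loss_norm_measurable[OF F]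
  show ?thesis unfolding norm_ratio_def by measurable
qed

end

section \<open>Deviation of the empirical risk of a fixed predictor\<close>

text \<open>The event that at least half of the batch means are further than \<open>r\<close> from \<open>m\<close>. It contains the event
  that the median of means is further than \<open>r\<close> from \<open>m\<close>, its measurability does not involve sorting, and
  with a single batch it is the deviation of the plain average.\<close>

definition blocks_deviate where
  "blocks_deviate l D I B b f m r \<longleftrightarrow>
     B \<le> 2 * card {c. c < B \<and> r < \<bar>mean_loss l D {i \<in> I. b i = c} f - m\<bar>}"

lemma empirical_risk_within:
  assumes "B > 0" and "\<not> blocks_deviate l D I (if cen = AVG then 1 else B)
      (if cen = AVG then (\<lambda>_. 0) else b) f m r"
  shows "\<bar>empirical_risk cen l D I B b f - m\<bar> \<le> r"
proof (cases cen)
  case AVG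
  then show ?thesis using assms(2) by (auto simp: blocks_deviate_def not_le)
next
  case MOM
  then show ?thesis
    using assms median_map_within[of B r "\<lambda>c. mean_loss l D {i \<in> I. b i = c} f" m]
    by (auto simp: blocks_deviate_def)
qed

lemma mean_loss_cong:
  "(\<And>i. i \<in> J \<Longrightarrow> D i = D' i) \<Longrightarrow> mean_loss l D J f = mean_loss l D' J f"
  by (simp add: mean_loss_def)

lemma blocks_deviate_cong:
  assumes "\<And>i. i \<in> I \<Longrightarrow> D i = D' i"
  shows "blocks_deviate l D I B b f m r = blocks_deviate l D' I B b f m r"
proof -
  have "mean_loss l D {i \<in> I. b i = c} f = mean_loss l D' {i \<in> I. b i = c} f" for c
    by (rule mean_loss_cong) (use assms in auto)
  then show ?thesis by (simp add: blocks_deviate_def)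
qed

lemma blocks_deviate_batch_cong:
  assumes "\<And>i. i \<in> I \<Longrightarrow> \<beta> i = \<beta>' i"
  shows "blocks_deviate l D I B \<beta> f x r = blocks_deviate l D I B \<beta>' f x r"
proof -
  have "{i \<in> I. \<beta> i = c} = {i \<in> I. \<beta>' i = c}" for c using assms by auto
  then show ?thesis by (simp add: blocks_deviate_def)
qed

text \<open>The second bound makes the batches large, of order \<open>n\<^sub>t\<^sub>e / log n\<close>; the third one makes the failure
  probability of the median of means summable over the grid.\<close>

lemma num_batches_bounds:
  assumes n: "n \<ge> 3" and X: "1 \<le> card \<Xi>" "card \<Xi> \<le> n" and A: "A > 0"
  defines "B \<equiv> num_batches A n \<Xi>"
  shows "0 < B" "real B \<le> (8 * A + 9) * ln (real n)" "(1 / 2) ^ B \<le> real n powr (- A) / real (card \<Xi>)"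
proof -
  define L where "L = ln (real n)"
  \<comment> \<open>This is \<open>log (1 / \<eta>)\<close>.\<close>
  define x where "x = A * L + ln (real (card \<Xi>))"
  have L: "1 \<le> L"
  proof -
    have "exp 1 \<le> real n" using exp_le n by (meson order_trans of_nat_mono numeral_le_real_of_nat_iff)
    then show ?thesis using n by (simp add: L_def ln_ge_iff)
  qed
  have x_eq: "exp (- x) = real n powr (- A) / real (card \<Xi>)"
  proof -
    have "- x = - A * L - ln (real (card \<Xi>))" by (simp add: x_def)
    then show ?thesis using n X by (simp only: exp_diff) (simp add: powr_def L_def)
  qed
  then have "ln (1 / (real n powr (- A) / real (card \<Xi>))) = x"
    by (metis exp_minus inverse_eq_divide minus_minus ln_exp)
  then have B: "B = nat \<lceil>8 * x\<rceil>" by (simp add: B_def num_batches_def Let_def)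
  have "0 \<le> ln (real (card \<Xi>))" "ln (real (card \<Xi>)) \<le> L" using X by (auto simp: L_def)
  moreover have AL: "0 < A * L" using A L by simp
  ultimately have x: "0 < x" "x \<le> A * L + L" by (auto simp: x_def)
  show "0 < B" using x by (simp add: B)
  have rB: "8 * x \<le> real B" "real B < 8 * x + 1"
    unfolding B using x(1) by linarith+
  have "8 * x \<le> 8 * (A * L + L)" using x(2) by simp
  then have "real B \<le> 8 * (A * L + L) + L" using rB(2) L by linarith
  then show "real B \<le> (8 * A + 9) * ln (real n)" by (simp add: L_def algebra_simps)
  have "(1 / 2) ^ B = exp (- (real B * ln 2))"
    by (simp add: exp_minus exp_of_nat_mult power_one_over inverse_eq_divide)
  also have "\<dots> \<le> exp (- x)"
  proof -
    have "x \<le> 8 * x * (1 / 2)" using x by simp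
    also have "\<dots> \<le> real B * ln 2"
      using rB x ln2_ge_two_thirds by (intro mult_mono) auto
    finally show ?thesis by simp
  qed
  finally show "(1 / 2) ^ B \<le> real n powr (- A) / real (card \<Xi>)" by (simp add: x_eq)
qed

text \<open>The constant is dictated by the median of means: with it, a batch has at least \<open>32 / t\<^sup>2\<close> elements
  for \<open>t\<close> the deviation rate, so that Chebyshev's inequality gives \<open>1/16\<close>.\<close>

definition deviation_rate :: "real \<Rightarrow> nat \<Rightarrow> nat \<Rightarrow> real" where
  "deviation_rate A n m = 8 * sqrt ((8 * A + 9) * ln (real n) / real m)"

lemma deviation_rate_tendsto_0:
  assumes "(\<lambda>n. ln (real n) / real (m n)) \<longlonglongrightarrow> 0"
  shows "(\<lambda>n. deviation_rate A n (m n)) \<longlonglongrightarrow> 0"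
proof -
  have "(\<lambda>n. 8 * sqrt ((8 * A + 9) * (ln (real n) / real (m n)))) \<longlonglongrightarrow> 8 * sqrt ((8 * A + 9) * 0)"
    by (intro tendsto_intros assms)
  then show ?thesis by (simp add: deviation_rate_def)
qed

context loss_model begin

text \<open>The bound on the second moment follows from \<open>x\<^sup>2 / 2 \<le> exp x - 1\<close> for the \<open>\<psi>\<^sub>1\<close> norm. In either case
  the loss is square integrable, in particular the risk is finite.\<close>

lemma loss_norm_lessD:
  assumes f: "f \<in> borel_measurable (feature_space p)" and less: "loss_norm nk l P f < ennreal c"
  defines "X \<equiv> (\<lambda>(x, y). l y (f x))"
  shows "0 < c" "integrable P X" "integrable P (\<lambda>z. (X z)\<^sup>2)" "expectation (\<lambda>z. (X z)\<^sup>2) \<le> 2 * c\<^sup>2"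
    and "nk = Psi1 \<Longrightarrow> (\<integral>\<^sup>+z. ennreal (exp (X z / c)) \<partial>P) \<le> 2"
    and "risk l P f = ennreal (expectation X)"
proof -
  have X[measurable]: "X \<in> borel_measurable P"
    unfolding X_def by (rule loss_measurable_P[OF f])
  have nonneg: "0 \<le> X z" for z by (simp add: X_def case_prod_beta' l_nonneg)
  show c: "0 < c" using less by (metis ennreal_neg not_le not_less_zero)
  have exp2: "(\<integral>\<^sup>+z. ennreal (exp (X z / c)) \<partial>P) \<le> 2" if Psi1: "nk = Psi1"
  proof -
    from less have "loss_norm Psi1 l P f < ennreal c" using Psi1 by simp
    then obtain C where C: "C > 0" "ennreal C < ennreal c"
        "(\<integral>\<^sup>+(x, y). ennreal (exp (\<bar>l y (f x)\<bar> / C)) \<partial>P) \<le> 2"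
      by (rule loss_norm_Psi1_lessD)
    then have "C \<le> c" by (simp add: ennreal_less_iff)
    from exp_moment_mono[OF C(1) this C(3)] show ?thesis
      by (simp add: X_def case_prod_beta' l_nonneg)
  qed
  show "nk = Psi1 \<Longrightarrow> (\<integral>\<^sup>+z. ennreal (exp (X z / c)) \<partial>P) \<le> 2" by (rule exp2)
  have sq: "(\<integral>\<^sup>+z. ennreal ((X z)\<^sup>2) \<partial>P) \<le> ennreal (2 * c\<^sup>2)"
  proof (cases nk)
    case Psi1
    have X_le: "(X z)\<^sup>2 \<le> 2 * c\<^sup>2 * (exp (X z / c) - 1)" for z
    proof -
      have "(X z / c)\<^sup>2 / 2 \<le> exp (X z / c) - 1"
        using exp_lower_Taylor_quadratic[of "X z / c"] nonneg[of z] c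
        by (smt (verit) divide_nonneg_pos)
      then have "2 * c\<^sup>2 * ((X z / c)\<^sup>2 / 2) \<le> 2 * c\<^sup>2 * (exp (X z / c) - 1)"
        by (intro mult_left_mono) auto
      then show ?thesis using c by (simp add: power_divide)
    qed
    have "(\<integral>\<^sup>+z. ennreal ((X z)\<^sup>2) \<partial>P) \<le> (\<integral>\<^sup>+z. ennreal (2 * c\<^sup>2) * (ennreal (exp (X z / c)) - 1) \<partial>P)"
    proof (intro nn_integral_mono)
      fix z
      have "ennreal ((X z)\<^sup>2) \<le> ennreal (2 * c\<^sup>2 * (exp (X z / c) - 1))"
        by (rule ennreal_leI[OF X_le])
      also have "\<dots> = ennreal (2 * c\<^sup>2) * ennreal (exp (X z / c) - 1)" by (rule ennreal_mult') simp
      also have "ennreal (exp (X z / c) - 1) = ennreal (exp (X z / c)) - 1"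
        using ennreal_minus[of 1 "exp (X z / c)"] by simp
      finally show "ennreal ((X z)\<^sup>2) \<le> ennreal (2 * c\<^sup>2) * (ennreal (exp (X z / c)) - 1)" .
    qed
    also have "\<dots> = ennreal (2 * c\<^sup>2) * ((\<integral>\<^sup>+z. ennreal (exp (X z / c)) \<partial>P) - (\<integral>\<^sup>+z. 1 \<partial>P))"
    proof (subst nn_integral_cmult, measurable, subst nn_integral_diff)
      show "AE z in P. 1 \<le> ennreal (exp (X z / c))"
        using nonneg c by (intro AE_I2) (auto simp flip: ennreal_1 intro!: ennreal_leI)
    qed (auto simp: emeasure_space_1)
    also have "\<dots> \<le> ennreal (2 * c\<^sup>2) * 1"
      using exp2[OF Psi1] by (intro mult_left_mono) (auto simp: emeasure_space_1 ennreal_minus_le_iff)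
    finally show ?thesis by simp
  next
    case L2
    let ?v = "\<integral>\<^sup>+z. ennreal ((X z)\<^sup>2) \<partial>P"
    have v: "?v \<noteq> \<infinity>" "sqrt (enn2real ?v) < c"
      using less L2 c by (auto simp: X_def case_prod_beta' Let_def ennreal_less_iff split: if_splits)
    have "(sqrt (enn2real ?v))\<^sup>2 \<le> c\<^sup>2" using v(2) by (intro power_mono) auto
    then have "enn2real ?v \<le> c\<^sup>2" by simp
    then have "enn2real ?v \<le> 2 * c\<^sup>2" by (smt (verit) zero_le_power2)
    then have "ennreal (enn2real ?v) \<le> ennreal (2 * c\<^sup>2)" by (rule ennreal_leI)
    moreover have "ennreal (enn2real ?v) = ?v" using v(1) by (simp add: less_top)
    ultimately show ?thesis by (simp only:)
  qed
  show X2: "integrable P (\<lambda>z. (X z)\<^sup>2)"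
    by (rule integrableI_nonneg) (use sq in \<open>auto intro: le_less_trans\<close>)
  show "expectation (\<lambda>z. (X z)\<^sup>2) \<le> 2 * c\<^sup>2"
    using sq by (subst (asm) nn_integral_eq_integral[OF X2]) (auto simp: ennreal_le_iff)
  show X1: "integrable P X"
    by (rule square_integrable_imp_integrable[OF X X2])
  show "risk l P f = ennreal (expectation X)"
    using nn_integral_eq_integral[OF X1] nonneg by (simp add: risk_def X_def case_prod_beta')
qed

lemma norm_lt_of_norm_le:
  assumes "loss_norm nk l P f \<le> ennreal C" and "0 \<le> C"
  shows "loss_norm nk l P f < ennreal ((C + 1) * (1 + enn2real (risk l P f)))"
proof -
  have "C * 1 < (C + 1) * (1 + enn2real (risk l P f))"
    by (rule mult_less_le_imp_less) (use assms(2) in auto)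
  then show ?thesis using assms by (auto intro!: le_less_trans[OF assms(1)] ennreal_lessI)
qed

text \<open>The strict inequality leaves room for both degenerate cases: if the risk is \<open>0\<close> then a finite ratio
  forces the norm to be \<open>0\<close>, and an infinite risk is excluded by the finite norm.\<close>

lemma norm_lt_of_ratio_le:
  assumes f: "f \<in> borel_measurable (feature_space p)"
    and le: "norm_ratio nk l P f \<le> ennreal C" and C: "0 \<le> C"
  shows "loss_norm nk l P f < ennreal ((C + 1) * (1 + enn2real (risk l P f)))"
proof -
  let ?N = "loss_norm nk l P f" and ?r = "enn2real (risk l P f)"
  have N: "?N \<noteq> \<infinity>" using le by (auto simp: norm_ratio_def top_unique split: if_splits)
  then obtain x where x: "?N = ennreal x" "0 \<le> x" by (metis ennreal_cases infinity_ennreal_def)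
  have "?N < ennreal (x + 1)" using x by (simp add: ennreal_less_iff)
  from loss_norm_lessD(6)[OF f this] have r: "risk l P f = ennreal ?r" "0 \<le> ?r" by auto
  have div: "ennreal x / ennreal ?r \<le> ennreal C" using le N x r by (simp add: norm_ratio_def)
  have "x \<le> C * ?r"
  proof (cases "?r = 0")
    case True
    then have "x = 0" using div x(2) C by (cases "x = 0") (auto simp: ennreal_divide_zero top_unique)
    then show ?thesis using True by simp
  next
    case False
    then have "x / ?r \<le> C" using div r(2) x(2) C by (simp add: divide_ennreal)
    then show ?thesis using False r(2) by (simp add: divide_le_eq)
  qed
  also have "\<dots> < C * ?r + (C + 1 + ?r)" using r(2) C by linarith
  also have "\<dots> = (C + 1) * (1 + ?r)" by (simp add: algebra_simps)
  finally show ?thesis using x by (simp add: ennreal_less_iff)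
qed

lemma average_deviation:
  assumes f: "f \<in> borel_measurable (feature_space p)" and less: "loss_norm Psi1 l P f < ennreal c"
    and I: "finite I" "I \<noteq> {}" and t: "0 \<le> t" "t \<le> 8"
  shows "measure (PiM I (\<lambda>_. P)) {D \<in> space (PiM I (\<lambda>_. P)).
      blocks_deviate l D I 1 (\<lambda>_. 0) f (enn2real (risk l P f)) (c * t)}
    \<le> 2 * exp (- (real (card I) * t\<^sup>2 / 32))"
proof -
  define X where "X = (\<lambda>(x, y). l y (f x))"
  note less' = loss_norm_lessD[OF f less, folded X_def]
  have nonneg: "0 \<le> X z" for z by (simp add: X_def case_prod_beta' l_nonneg)
  have R: "enn2real (risk l P f) = expectation X"
    using less'(6) nonneg by simp
  have *: "blocks_deviate l D I 1 (\<lambda>_. 0) f m r \<longleftrightarrow> r < \<bar>(\<Sum>i\<in>I. X (D i)) / real (card I) - m\<bar>"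
    for D m r
  proof -
    have one: "{c. c < (1::nat) \<and> Q c} = (if Q 0 then {0} else {})" for Q by auto
    show ?thesis
      unfolding blocks_deviate_def one by (simp add: mean_loss_def X_def case_prod_beta')
  qed
  show ?thesis unfolding * R
    using subexponential_mean_deviation[OF I _ nonneg less'(1) less'(5)[OF refl] t]
      loss_measurable_P[OF f] by (simp add: X_def)
qed

lemma median_of_means_deviation:
  assumes f: "f \<in> borel_measurable (feature_space p)" and less: "loss_norm nk l P f < ennreal c"
    and I: "finite I" and t: "0 < t"
    and blocks: "\<And>k. k < B \<Longrightarrow> 32 \<le> real (card {i \<in> I. b i = k}) * t\<^sup>2"
  shows "measure (PiM I (\<lambda>_. P)) {D \<in> space (PiM I (\<lambda>_. P)).
      blocks_deviate l D I B b f (enn2real (risk l P f)) (c * t)} \<le> (1 / 2) ^ B"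
proof -
  define X where "X = (\<lambda>(x, y). l y (f x))"
  note less' = loss_norm_lessD[OF f less, folded X_def]
  have nonneg: "0 \<le> X z" for z by (simp add: X_def case_prod_beta' l_nonneg)
  have Xm[measurable]: "X \<in> borel_measurable P" unfolding X_def by (rule loss_measurable_P[OF f])
  have R: "enn2real (risk l P f) = expectation X"
    using less'(6) nonneg by simp
  let ?K = "\<lambda>k. {i \<in> I. b i = k}"
  have mean: "mean_loss l D J f = (\<Sum>i\<in>J. X (D i)) / real (card J)" for D J
    by (simp add: mean_loss_def X_def case_prod_beta')
  show ?thesis unfolding blocks_deviate_def R mean
  proof (rule majority_of_blocks_le[where K="?K"])
    show "disjoint_family_on ?K {..<B}" by (auto simp: disjoint_family_on_def)
    fix k assume k: "k < B"
    have ne: "?K k \<noteq> {}"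
    proof
      assume "?K k = {}"
      then have "card (?K k) = 0" by (simp only: card.empty)
      with blocks[OF k] show False by simp
    qed
    show "{D \<in> space (PiM (?K k) (\<lambda>_. P)). c * t < \<bar>(\<Sum>i\<in>?K k. X (D i)) / real (card (?K k)) - expectation X\<bar>}
        \<in> sets (PiM (?K k) (\<lambda>_. P))" by measurable
    have "measure (PiM I (\<lambda>_. P)) {D \<in> space (PiM I (\<lambda>_. P)).
          c * t < \<bar>(\<Sum>i\<in>?K k. X (D i)) / real (card (?K k)) - expectation X\<bar>}
        \<le> expectation (\<lambda>x. (X x)\<^sup>2) / (real (card (?K k)) * (c * t)\<^sup>2)"
      by (rule mean_chebyshev[OF I _ ne Xm less'(2,3)]) (use less'(1) t in auto)
    also have "\<dots> \<le> (2 * c\<^sup>2) / (32 * c\<^sup>2)"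
    proof (rule frac_le)
      show "32 * c\<^sup>2 \<le> real (card (?K k)) * (c * t)\<^sup>2"
        using mult_right_mono[OF blocks[OF k], of "c\<^sup>2"] by (simp add: power_mult_distrib mult_ac)
    qed (use less' in auto)
    also have "\<dots> = 1 / 16" using less'(1) by simp
    finally show "measure (PiM I (\<lambda>_. P)) {D \<in> space (PiM I (\<lambda>_. P)).
          c * t < \<bar>(\<Sum>i\<in>?K k. X (D i)) / real (card (?K k)) - expectation X\<bar>} \<le> 1 / 16" .
  qed auto
qed

text \<open>The two estimators of the risk, reduced to the same event about batches. In the bound, \<open>2 / n\<close> is
  the contribution of the average and the power of \<open>n\<close> that of the median of means, and dividing by the
  size of the grid prepares a union bound.\<close>

lemma empirical_risk_deviation:
  assumes n: "n \<ge> 3" and X: "1 \<le> card \<Xi>" "card \<Xi> \<le> n" and A: "A > 0"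
    and I: "finite I" "card I > 0" and t: "deviation_rate A n (card I) \<le> 8"
    and cen: "cen = AVG \<Longrightarrow> nk = Psi1"
    and b: "cen = MOM \<Longrightarrow> balanced_batches (num_batches A n \<Xi>) I b"
    and f: "f \<in> borel_measurable (feature_space p)" and less: "loss_norm nk l P f < ennreal c"
  shows "measure (PiM I (\<lambda>_. P)) {D \<in> space (PiM I (\<lambda>_. P)).
      blocks_deviate l D I (if cen = AVG then 1 else num_batches A n \<Xi>) (if cen = AVG then (\<lambda>_. 0) else b)
        f (enn2real (risk l P f)) (c * deviation_rate A n (card I))}
    \<le> (2 / real n + real n powr (- A)) / real (card \<Xi>)"
proof -
  define t where "t = deviation_rate A n (card I)"
  define B where "B = num_batches A n \<Xi>"
  define m where "m = real (card I)"
  have m: "m > 0" using I by (simp add: m_def)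
  have L: "0 < ln (real n)" using n by simp
  have t2: "t\<^sup>2 = 64 * ((8 * A + 9) * ln (real n) / m)"
    using A L m by (simp add: t_def deviation_rate_def m_def[symmetric] power_mult_distrib)
  have t0: "0 < t" using A L m by (simp add: t_def deviation_rate_def m_def[symmetric])
  have t8: "t \<le> 8" using t by (simp add: t_def)
  show ?thesis
  proof (cases cen)
    case AVG
    have "m * t\<^sup>2 / 32 = 2 * (8 * A + 9) * ln (real n)" using m by (simp add: t2)
    also have "\<dots> \<ge> 2 * ln (real n)" using A L by (intro mult_right_mono) auto
    finally have "exp (- (m * t\<^sup>2 / 32)) \<le> exp (- (2 * ln (real n)))" by simp
    also have "exp (2 * ln (real n)) = (real n)\<^sup>2"
      using n by (simp add: exp_double power2_eq_square flip: mult_2) 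
    then have "exp (- (2 * ln (real n))) = 1 / (real n)\<^sup>2" by (simp add: exp_minus inverse_eq_divide)
    finally have "2 * exp (- (m * t\<^sup>2 / 32)) \<le> 2 / real n / real n" by (simp add: power2_eq_square)
    also have "\<dots> \<le> (2 / real n + real n powr (- A)) / real (card \<Xi>)"
      using X by (intro frac_le) auto
    finally show ?thesis
      using average_deviation[OF f _ I(1) _ less_imp_le[OF t0] t8, of c] less cen AVG I(2)
      by (fastforce simp: m_def t_def)
  next
    case MOM
    note Bb = num_batches_bounds[OF n X A, folded B_def]
    define x where "x = m / real B"
    have "m * t\<^sup>2 \<le> m * 8\<^sup>2" using t0 t8 m by (intro mult_left_mono power_mono) auto
    moreover have "64 * real B \<le> m * t\<^sup>2" using Bb(2) m by (simp add: t2)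
    ultimately have "real B \<le> m" by simp
    then have x1: "1 \<le> x" using Bb(1) by (simp add: x_def)
    have xt: "64 \<le> x * t\<^sup>2" using \<open>64 * real B \<le> m * t\<^sup>2\<close> Bb(1) by (simp add: x_def field_simps)
    have blk: "32 \<le> real (card {i \<in> I. b i = k}) * t\<^sup>2" if "k < B" for k
    proof -
      have "int (card {i \<in> I. b i = k}) \<in> {\<lfloor>x\<rfloor>, \<lceil>x\<rceil>}"
        using b[OF MOM] that unfolding balanced_batches_def B_def[symmetric] x_def m_def by blast
      then have "\<lfloor>x\<rfloor> \<le> int (card {i \<in> I. b i = k})" using floor_le_ceiling[of x] by auto
      moreover have "1 \<le> \<lfloor>x\<rfloor>" "x < of_int \<lfloor>x\<rfloor> + 1" using x1 by linarith+
      moreover have "of_int \<lfloor>x\<rfloor> \<le> real (card {i \<in> I. b i = k})"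
        using \<open>\<lfloor>x\<rfloor> \<le> _\<close> by (metis of_int_le_iff of_int_of_nat_eq)
      ultimately have "x / 2 \<le> real (card {i \<in> I. b i = k})" by linarith
      then have "x / 2 * t\<^sup>2 \<le> real (card {i \<in> I. b i = k}) * t\<^sup>2" by (intro mult_right_mono) auto
      then show ?thesis using xt by linarith
    qed
    have "(1 / 2) ^ B \<le> (2 / real n + real n powr (- A)) / real (card \<Xi>)"
      using Bb(3) by (rule order_trans) (intro divide_right_mono, auto)
    with median_of_means_deviation[OF f less I(1) t0, of B b, OF blk]
    show ?thesis unfolding B_def t_def using MOM by simp
  qed
qed

end

section \<open>Conditioning on the random split\<close>

context prob_space begin

text \<open>Fubini: integrate over the coordinates in \<open>I\<close> first, with the others fixed.\<close>

lemma product_measure_le_sections: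
  assumes "finite K" "I \<subseteq> K" and E[measurable]: "E \<in> sets (PiM K (\<lambda>_. M))" and "0 \<le> \<delta>"
    and sec: "\<And>y. y \<in> space (PiM (K - I) (\<lambda>_. M)) \<Longrightarrow>
      measure (PiM I (\<lambda>_. M)) {x \<in> space (PiM I (\<lambda>_. M)). merge (K - I) I (y, x) \<in> E} \<le> \<delta>"
  shows "measure (PiM K (\<lambda>_. M)) E \<le> \<delta>"
proof -
  interpret K: prob_space "PiM K (\<lambda>_. M)" by (rule product_measure_prob_space)
  interpret I: prob_space "PiM I (\<lambda>_. M)" by (rule product_measure_prob_space)
  interpret C: prob_space "PiM (K - I) (\<lambda>_. M)" by (rule product_measure_prob_space)
  interpret product_sigma_finite "\<lambda>_. M" ..
  have KI: "(K - I) \<union> I = K" using assms(2) by auto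
  have fin: "finite I" "finite (K - I)" using assms(1,2) by (auto intro: finite_subset)
  have ind: "(indicator E :: _ \<Rightarrow> ennreal) \<in> borel_measurable (PiM ((K - I) \<union> I) (\<lambda>_. M))"
    unfolding KI by measurable
  have "emeasure (PiM K (\<lambda>_. M)) E = (\<integral>\<^sup>+D. indicator E D \<partial>PiM ((K - I) \<union> I) (\<lambda>_. M))"
    unfolding KI by simp
  also have "\<dots> = (\<integral>\<^sup>+y. (\<integral>\<^sup>+x. indicator E (merge (K - I) I (y, x)) \<partial>PiM I (\<lambda>_. M)) \<partial>PiM (K - I) (\<lambda>_. M))"
    by (rule product_nn_integral_fold[OF _ fin(2,1) ind]) auto
  also have "\<dots> \<le> (\<integral>\<^sup>+y. ennreal \<delta> \<partial>PiM (K - I) (\<lambda>_. M))"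
  proof (rule nn_integral_mono)
    fix y assume y: "y \<in> space (PiM (K - I) (\<lambda>_. M))"
    let ?S = "{x \<in> space (PiM I (\<lambda>_. M)). merge (K - I) I (y, x) \<in> E}"
    have "(\<lambda>x. merge (K - I) I (y, x)) \<in> PiM I (\<lambda>_. M) \<rightarrow>\<^sub>M PiM K (\<lambda>_. M)"
      using measurable_compose[OF measurable_Pair1'[OF y] measurable_merge[where J=I]] unfolding KI .
    then have S: "?S \<in> sets (PiM I (\<lambda>_. M))" by measurable
    have "(\<integral>\<^sup>+x. indicator E (merge (K - I) I (y, x)) \<partial>PiM I (\<lambda>_. M))
        = (\<integral>\<^sup>+x. indicator ?S x \<partial>PiM I (\<lambda>_. M))"
      by (intro nn_integral_cong) (auto simp: indicator_def)
    also have "\<dots> = emeasure (PiM I (\<lambda>_. M)) ?S" using S by simp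
    also have "\<dots> \<le> ennreal \<delta>" using sec[OF y] assms(4) by (simp add: I.emeasure_eq_measure)
    finally show "(\<integral>\<^sup>+x. indicator E (merge (K - I) I (y, x)) \<partial>PiM I (\<lambda>_. M)) \<le> ennreal \<delta>" .
  qed
  also have "\<dots> = ennreal \<delta>" by (simp add: C.emeasure_space_1)
  finally show ?thesis using assms(4) by (simp add: K.emeasure_eq_measure)
qed

text \<open>An independent variable with countable range may be treated as a constant: sum over its values.\<close>

lemma indep_rvs_event_le:
  assumes ind: "indep_rvs M MX X (count_space UNIV) V"
    and K: "countable K" "\<And>w. w \<in> space M \<Longrightarrow> V w \<in> K"
    and E: "\<And>v. v \<in> K \<Longrightarrow> E v \<in> sets MX"
  shows "{w \<in> space M. X w \<in> E (V w)} \<in> sets M"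
    and "0 \<le> \<delta> \<Longrightarrow> (\<And>v. v \<in> K \<Longrightarrow> measure (distr M MX X) (E v) \<le> \<delta>) \<Longrightarrow>
      measure M {w \<in> space M. X w \<in> E (V w)} \<le> \<delta>"
proof -
  have X: "X \<in> M \<rightarrow>\<^sub>M MX" and V: "V \<in> M \<rightarrow>\<^sub>M count_space UNIV"
    using ind by (auto simp: indep_rvs_def)
  let ?X = "\<lambda>v. X -` E v \<inter> space M" and ?V = "\<lambda>v. V -` {v} \<inter> space M"
  let ?A = "{w \<in> space M. X w \<in> E (V w)}"
  have sX: "?X v \<in> sets M" if "v \<in> K" for v using X E[OF that] by measurable
  have sV: "?V v \<in> sets M" for v using V by measurable
  have A: "?A = (\<Union>v\<in>K. ?X v \<inter> ?V v)" using K(2) by auto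
  show m: "?A \<in> sets M"
    unfolding A using K(1) sX sV by (intro sets.countable_UN'') auto
  assume d: "0 \<le> \<delta>" and le: "\<And>v. v \<in> K \<Longrightarrow> measure (distr M MX X) (E v) \<le> \<delta>"
  have "emeasure M (?X v \<inter> ?V v) \<le> ennreal \<delta> * emeasure M (?V v)" if v: "v \<in> K" for v
  proof -
    have "prob (?X v \<inter> ?V v) = prob (?X v) * prob (?V v)"
      by (rule indep_setD) (use ind E[OF v] in \<open>auto simp: indep_rvs_def\<close>)
    also have "\<dots> \<le> \<delta> * prob (?V v)"
      using le[OF v] by (intro mult_right_mono) (auto simp: measure_distr[OF X E[OF v]])
    finally show ?thesis using d by (simp add: emeasure_eq_measure flip: ennreal_mult)
  qed
  then have "emeasure M ?A \<le> (\<integral>\<^sup>+v. ennreal \<delta> * emeasure M (?V v) \<partial>count_space K)"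
    unfolding A using K(1) sX sV
    by (subst emeasure_UN_countable) (auto simp: disjoint_family_on_def intro!: nn_integral_mono)
  also have "\<dots> = ennreal \<delta> * emeasure M (\<Union>v\<in>K. ?V v)"
    using K(1) sV by (subst emeasure_UN_countable) (auto simp: disjoint_family_on_def nn_integral_cmult)
  also have "\<dots> \<le> ennreal \<delta> * 1"
    by (intro mult_left_mono) (simp_all add: emeasure_le_1)
  finally show "measure M ?A \<le> \<delta>" using d by (simp add: emeasure_eq_measure)
qed

lemma measure_le_of_cover:
  assumes "E \<subseteq> B1 \<union> B2 \<union> B3" "B1 \<in> events" "B2 \<in> events" "B3 \<in> events"
  shows "prob E \<le> prob B1 + prob B2 + prob B3"
proof -
  have "prob E \<le> prob (B1 \<union> B2 \<union> B3)" using assms by (intro finite_measure_mono) auto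
  also have "\<dots> \<le> prob B1 + prob B2 + prob B3"
    using assms measure_Un_le[of "B1 \<union> B2" M B3] measure_Un_le[of B1 M B2] by auto
  finally show ?thesis .
qed

end

context loss_model begin

lemma mean_loss_measurable:
  assumes F: "(\<lambda>(D, x). F D x) \<in> borel_measurable (PiM K (\<lambda>_. obs_space p) \<Otimes>\<^sub>M feature_space p)"
    and J: "J \<subseteq> K"
  shows "(\<lambda>D. mean_loss l D J (F D)) \<in> borel_measurable (PiM K (\<lambda>_. P))"
  unfolding mean_loss_def
proof (intro borel_measurable_divide borel_measurable_sum borel_measurable_const)
  fix i assume "i \<in> J"
  then have i: "(\<lambda>D. D i) \<in> PiM K (\<lambda>_. P) \<rightarrow>\<^sub>M P" using J by (intro measurable_component_singleton) auto
  have F': "(\<lambda>(D, x). F D x) \<in> borel_measurable (PiM K (\<lambda>_. P) \<Otimes>\<^sub>M feature_space p)"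
    using F by (subst measurable_cong_sets[OF sets_pair_measure_cong[OF sets_PiM_P refl] refl])
  have "(\<lambda>D. (D, fst (D i))) \<in> PiM K (\<lambda>_. P) \<rightarrow>\<^sub>M PiM K (\<lambda>_. P) \<Otimes>\<^sub>M feature_space p"
    by (intro measurable_Pair measurable_ident_sets refl measurable_compose[OF i fst_measurable])
  from measurable_compose[OF this F']
  have "(\<lambda>D. F D (fst (D i))) \<in> borel_measurable (PiM K (\<lambda>_. P))" by simp
  then show "(\<lambda>D. l (snd (D i)) (F D (fst (D i)))) \<in> borel_measurable (PiM K (\<lambda>_. P))"
    by (intro loss_measurable measurable_compose[OF i snd_measurable])
qed

lemma blocks_deviate_sets:
  assumes F: "(\<lambda>(D, x). F D x) \<in> borel_measurable (PiM K (\<lambda>_. obs_space p) \<Otimes>\<^sub>M feature_space p)"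
    and I: "I \<subseteq> K" and [measurable]: "m \<in> borel_measurable (PiM K (\<lambda>_. P))" "r \<in> borel_measurable (PiM K (\<lambda>_. P))"
  shows "{D \<in> space (PiM K (\<lambda>_. P)). blocks_deviate l D I B b (F D) (m D) (r D)} \<in> sets (PiM K (\<lambda>_. P))"
proof -
  have [measurable]: "(\<lambda>D. mean_loss l D {i \<in> I. b i = c} (F D)) \<in> borel_measurable (PiM K (\<lambda>_. P))" for c
    by (rule mean_loss_measurable[OF F]) (use I in auto)
  have card: "real (card {c. c < B \<and> Q c}) = (\<Sum>c<B. if Q c then 1 else 0)" for Q
    by (simp add: sum.If_cases Int_def)
  have nat_real: "(B \<le> 2 * k) = (real B \<le> 2 * real k)" for k by linarith
  have "blocks_deviate l D I B b (F D) (m D) (r D) \<longleftrightarrow>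
      real B \<le> 2 * (\<Sum>c<B. if r D < \<bar>mean_loss l D {i \<in> I. b i = c} (F D) - m D\<bar> then 1 else 0)" for D
    unfolding blocks_deviate_def nat_real card ..
  then show ?thesis by simp
qed

text \<open>The predictor is built from observations outside \<open>I\<close>. Once these are fixed, the predictor, its risk
  and the threshold are constants, and only the observations in \<open>I\<close> are random.\<close>

lemma predictor_deviation:
  fixes C t \<delta> :: real
  assumes ft: "measurable_procedure ft" and I: "I \<subseteq> {..<n}"
    and s: "\<And>j. j \<in> {1..M} \<Longrightarrow> s j \<subseteq> {..<n} - I" and \<delta>: "0 \<le> \<delta>"
    and dev: "\<And>f c. f \<in> borel_measurable (feature_space p) \<Longrightarrow> loss_norm nk l P f < ennreal c \<Longrightarrow>
      measure (PiM I (\<lambda>_. P)) {D \<in> space (PiM I (\<lambda>_. P)).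
        blocks_deviate l D I B b f (enn2real (risk l P f)) (c * t)} \<le> \<delta>"
  defines "F \<equiv> \<lambda>D. average_predictor ft p M D s"
  defines "c \<equiv> \<lambda>D. C * (1 + enn2real (risk l P (F D)))"
  defines "E \<equiv> {D \<in> space (iid_law P n). loss_norm nk l P (F D) < ennreal (c D) \<and>
        blocks_deviate l D I B b (F D) (enn2real (risk l P (F D))) (c D * t)}"
  shows "E \<in> sets (iid_law P n)" and "measure (iid_law P n) E \<le> \<delta>"
proof -
  have fin: "finite (s j)" if "j \<in> {1..M}" for j
    using s[OF that] by (rule finite_subset) simp
  have Fm: "(\<lambda>(D, x). F D x) \<in> borel_measurable (PiM {..<n} (\<lambda>_. obs_space p) \<Otimes>\<^sub>M feature_space p)"
    unfolding F_def by (rule measurable_average_predictor[OF ft]) (use s fin in blast)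
  have FmP: "(\<lambda>(D, x). F D x) \<in> borel_measurable (PiM {..<n} (\<lambda>_. P) \<Otimes>\<^sub>M feature_space p)"
    using Fm by (subst measurable_cong_sets[OF sets_pair_measure_cong[OF sets_PiM_P refl] refl])
  note [measurable] = risk_measurable[OF FmP] loss_norm_measurable[OF FmP]
  have [measurable]: "c \<in> borel_measurable (PiM {..<n} (\<lambda>_. P))" unfolding c_def by measurable
  have [measurable]: "{D \<in> space (PiM {..<n} (\<lambda>_. P)).
      blocks_deviate l D I B b (F D) (enn2real (risk l P (F D))) (c D * t)} \<in> sets (PiM {..<n} (\<lambda>_. P))"
    by (rule blocks_deviate_sets[OF Fm I]) measurable
  show E: "E \<in> sets (iid_law P n)"
    unfolding E_def iid_law_def by measurable
  show "measure (iid_law P n) E \<le> \<delta>"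
    unfolding iid_law_def
  proof (rule product_measure_le_sections[OF _ I _ \<delta>])
    show "E \<in> sets (PiM {..<n} (\<lambda>_. P))" using E by (simp add: iid_law_def)
    fix y assume y: "y \<in> space (PiM ({..<n} - I) (\<lambda>_. P))"
    let ?m = "\<lambda>x. merge ({..<n} - I) I (y, x)"
    have Fy: "F (?m x) = F y" for x
      unfolding F_def by (intro average_predictor_cong dataset_cong fin) (use s in \<open>auto simp: merge_def\<close>)
    have Fym: "F y \<in> borel_measurable (feature_space p)"
      unfolding F_def
    proof (rule measurable_section[OF measurable_average_predictor[OF ft]])
      show "y \<in> space (PiM ({..<n} - I) (\<lambda>_. obs_space p))"
        using y unfolding sets_eq_imp_space_eq[OF sets_PiM_P] .
    qed (use s fin in blast)
    have bd: "blocks_deviate l (?m x) I B b f m r = blocks_deviate l x I B b f m r" for x f m r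
      by (rule blocks_deviate_cong) (auto simp: merge_def)
    show "measure (PiM I (\<lambda>_. P)) {x \<in> space (PiM I (\<lambda>_. P)). ?m x \<in> E} \<le> \<delta>"
    proof (cases "loss_norm nk l P (F y) < ennreal (c y)")
      case True
      interpret I: prob_space "PiM I (\<lambda>_. P)" by (rule product_measure_prob_space)
      have "{x \<in> space (PiM I (\<lambda>_. P)). ?m x \<in> E} \<subseteq> {D \<in> space (PiM I (\<lambda>_. P)).
          blocks_deviate l D I B b (F y) (enn2real (risk l P (F y))) (c y * t)}"
        by (auto simp: E_def c_def Fy bd)
      moreover have "{D \<in> space (PiM I (\<lambda>_. P)).
          blocks_deviate l D I B b (F y) (enn2real (risk l P (F y))) (c y * t)} \<in> sets (PiM I (\<lambda>_. P))"
        by (rule blocks_deviate_sets[where F="\<lambda>_. F y"])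
           (use measurable_compose[OF measurable_snd Fym] in \<open>auto simp: case_prod_beta'\<close>)
      ultimately show ?thesis
        using I.finite_measure_mono dev[OF Fym True] by (meson order_trans)
    next
      case False
      then have "{x \<in> space (PiM I (\<lambda>_. P)). ?m x \<in> E} = {}" by (auto simp: E_def c_def Fy)
      then show ?thesis using \<delta> by (simp only: measure_empty)
    qed
  qed simp
qed

lemma iid_law_subset:
  assumes J: "J \<subseteq> {..<n}" and E: "E \<in> sets (iid_law P (card J))"
  shows "measure (iid_law P n) {D \<in> space (iid_law P n). (\<lambda>i\<in>{..<card J}. D (sorted_list_of_set J ! i)) \<in> E}
    = measure (iid_law P (card J)) E"
proof -
  let ?r = "\<lambda>D. \<lambda>i\<in>{..<card J}. D (sorted_list_of_set J ! i)"
  have fin: "finite J" using J by (rule finite_subset) simp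
  have "distr (PiM {..<n} (\<lambda>_. P)) (PiM {..<card J} (\<lambda>_. P)) ?r = PiM {..<card J} (\<lambda>_. P)"
  proof (rule distr_PiM_reindex)
    show "inj_on ((!) (sorted_list_of_set J)) {..<card J}"
      by (rule inj_on_nth) auto
    show "(!) (sorted_list_of_set J) \<in> {..<card J} \<rightarrow> {..<n}"
      using reindex_into[OF J fin] by auto
  qed (rule prob_space_axioms)
  then have "measure (PiM {..<card J} (\<lambda>_. P)) E = measure (distr (PiM {..<n} (\<lambda>_. P)) (PiM {..<card J} (\<lambda>_. P)) ?r) E"
    by simp
  also have "\<dots> = measure (PiM {..<n} (\<lambda>_. P)) (?r -` E \<inter> space (PiM {..<n} (\<lambda>_. P)))"
    by (rule measure_distr[OF measurable_reindex[OF J fin]]) (use E in \<open>simp add: iid_law_def\<close>)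
  also have "?r -` E \<inter> space (PiM {..<n} (\<lambda>_. P)) = {D \<in> space (PiM {..<n} (\<lambda>_. P)). ?r D \<in> E}" by auto
  finally show ?thesis by (simp add: iid_law_def)
qed

lemma subset_risk_law:
  assumes ft: "measurable_procedure ft" and J: "J \<subseteq> {..<n}"
  shows "measure (iid_law P n) {D \<in> space (iid_law P n). a < risk l P (ft p (dataset D J))}
    = measure (iid_law P (card J)) {D \<in> space (iid_law P (card J)). a < risk l P (ft p (dataset D {..<card J}))}"
proof -
  let ?r = "\<lambda>D. \<lambda>i\<in>{..<card J}. D (sorted_list_of_set J ! i)"
  have fin: "finite J" using J by (rule finite_subset) simp
  let ?E = "{D \<in> space (iid_law P (card J)). a < risk l P (ft p (dataset D {..<card J}))}"
  have E: "?E \<in> sets (iid_law P (card J))"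
    using dataset_risk_measurable[OF ft, of "{..<card J}" "card J"] by measurable
  have "?r D \<in> space (iid_law P (card J))" if "D \<in> space (iid_law P n)" for D
    using measurable_space[OF measurable_reindex[OF J fin]] that by (simp add: iid_law_def)
  then have "{D \<in> space (iid_law P n). ?r D \<in> ?E} = {D \<in> space (iid_law P n). a < risk l P (ft p (dataset D J))}"
    by (auto simp: dataset_reindex[OF fin, symmetric])
  with iid_law_subset[OF J E] show ?thesis by simp
qed

text \<open>Jensen's inequality inside the integral.\<close>

lemma risk_average_le:
  assumes convex: "\<And>y. convex_on UNIV (l y)" and "M \<ge> 1"
    and meas: "\<And>j. j \<in> {1..M} \<Longrightarrow> ft p (dataset D (s j)) \<in> borel_measurable (feature_space p)"
    and le: "\<And>j. j \<in> {1..M} \<Longrightarrow> risk l P (ft p (dataset D (s j))) \<le> a"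
  shows "risk l P (average_predictor ft p M D s) \<le> a"
proof -
  let ?f = "\<lambda>j. ft p (dataset D (s j))"
  let ?g = "\<lambda>j z. ennreal (l (snd z) (?f j (fst z)))"
  have gm: "?g j \<in> borel_measurable P" if "j \<in> {1..M}" for j
    using loss_measurable_P[OF meas[OF that]] by (simp add: case_prod_beta')
  have jensen: "l y (average_predictor ft p M D s x) \<le> (\<Sum>j=1..M. 1 / real M * l y (?f j x))" for x y
  proof -
    have "average_predictor ft p M D s x = (\<Sum>j=1..M. (1 / real M) *\<^sub>R ?f j x)"
      by (simp add: average_predictor_def sum_divide_distrib)
    then show ?thesis
      using convex_on_sum[of "{1..M}" UNIV "l y" "\<lambda>_. 1 / real M" "\<lambda>j. ?f j x"] convex assms(2) by simp
  qed
  have "risk l P (average_predictor ft p M D s) \<le> (\<integral>\<^sup>+z. (\<Sum>j=1..M. ennreal (1 / real M) * ?g j z) \<partial>P)"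
    unfolding risk_def case_prod_beta'
  proof (intro nn_integral_mono)
    fix z
    have "ennreal (l (snd z) (average_predictor ft p M D s (fst z)))
        \<le> ennreal (\<Sum>j=1..M. 1 / real M * l (snd z) (?f j (fst z)))"
      by (rule ennreal_leI[OF jensen])
    also have "\<dots> = (\<Sum>j=1..M. ennreal (1 / real M * l (snd z) (?f j (fst z))))"
      by (rule sum_ennreal[symmetric]) (simp add: l_nonneg)
    also have "\<dots> = (\<Sum>j=1..M. ennreal (1 / real M) * ?g j z)"
      by (intro sum.cong refl ennreal_mult') simp
    finally show "ennreal (l (snd z) (average_predictor ft p M D s (fst z)))
        \<le> (\<Sum>j=1..M. ennreal (1 / real M) * ?g j z)" .
  qed
  also have "\<dots> = (\<Sum>j=1..M. ennreal (1 / real M) * risk l P (?f j))"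
    using gm by (subst nn_integral_sum) (auto simp: nn_integral_cmult risk_def case_prod_beta' intro!: sum.cong)
  also have "\<dots> \<le> (\<Sum>j=1..M. ennreal (1 / real M) * a)"
    by (intro sum_mono mult_left_mono le) auto
  also have "\<dots> = ennreal (real M) * ennreal (1 / real M) * a"
    by (simp add: mult.assoc ennreal_of_nat_eq_real_of_nat)
  also have "ennreal (real M) * ennreal (1 / real M) = 1"
    using assms(2) by (simp flip: ennreal_mult)
  finally show ?thesis by simp
qed

end

section \<open>The zero-step procedure at a fixed sample size\<close>

lemma balanced_batches_cong:
  assumes "\<And>i. i \<in> I \<Longrightarrow> \<beta> i = \<beta>' i"
  shows "balanced_batches B I \<beta> = balanced_batches B I \<beta>'"
proof -
  have "\<beta> ` I = \<beta>' ` I" "{i \<in> I. \<beta> i = c} = {i \<in> I. \<beta>' i = c}" for c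
    using assms by (auto simp: image_iff)
  then show ?thesis by (simp add: balanced_batches_def)
qed

text \<open>A test set, the index sets of all subsamples as a function of \<open>(\<xi>, j)\<close>, and the batch labels.\<close>

type_synonym random_split = "nat set \<times> (nat \<times> nat \<Rightarrow> nat set) \<times> (nat \<Rightarrow> nat)"

text \<open>The zero-step procedure for one sample size \<open>n\<close>, with test size \<open>m\<close>. The split
  enters through its independence of the data and the combinatorial constraints on its parts.\<close>

locale zero_step_sample = loss_model P p l + W: prob_space \<Omega>
  for P :: "obs measure" and p :: nat and l :: "real \<Rightarrow> real \<Rightarrow> real" and \<Omega> :: "'w measure" +
  fixes ft :: procedure and n m M :: nat and \<Xi> :: "nat set" and sz :: "nat \<Rightarrow> nat"
    and cen :: centering and nk :: norm_kind and A :: real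
    and Z :: "'w \<Rightarrow> nat \<Rightarrow> obs" and T :: "'w \<Rightarrow> nat set"
    and S :: "'w \<Rightarrow> nat \<Rightarrow> nat \<Rightarrow> nat set" and b :: "'w \<Rightarrow> nat \<Rightarrow> nat"
  assumes ft: "measurable_procedure ft"
    and convex: "convex_on UNIV (l y)"
    and finite_candidates: "finite \<Xi>"
    and law: "distr \<Omega> (PiM {..<n} (\<lambda>_. obs_space p)) Z = iid_law P n"
    and indep: "indep_rvs \<Omega> (PiM {..<n} (\<lambda>_. obs_space p)) Z (count_space UNIV)
        (\<lambda>w. (T w, restrict (\<lambda>(\<xi>, j). S w \<xi> j) (\<Xi> \<times> {1..M}), restrict (b w) {..<n}))"
    and test: "w \<in> space \<Omega> \<Longrightarrow> T w \<subseteq> {..<n}" "w \<in> space \<Omega> \<Longrightarrow> card (T w) = m"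
    and subsets: "w \<in> space \<Omega> \<Longrightarrow> \<xi> \<in> \<Xi> \<Longrightarrow> j \<in> {1..M} \<Longrightarrow> S w \<xi> j \<subseteq> {..<n} - T w"
      "w \<in> space \<Omega> \<Longrightarrow> \<xi> \<in> \<Xi> \<Longrightarrow> j \<in> {1..M} \<Longrightarrow> card (S w \<xi> j) = sz \<xi>"
    and batches: "cen = MOM \<Longrightarrow> w \<in> space \<Omega> \<Longrightarrow> balanced_batches (num_batches A n \<Xi>) (T w) (b w)"
begin

definition fhat :: "'w \<Rightarrow> nat \<Rightarrow> feature \<Rightarrow> real" where
  "fhat w \<xi> = average_predictor ft p M (Z w) (S w \<xi>)"

text \<open>The default value \<open>0\<close> at infinite risk is harmless, because every bound on a norm of the loss makes
  the risk finite.\<close>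

definition fit_risk :: "'w \<Rightarrow> nat \<Rightarrow> real" where
  "fit_risk w \<xi> = enn2real (risk l P (fhat w \<xi>))"

definition draw :: "'w \<Rightarrow> random_split" where
  "draw w = (T w, restrict (\<lambda>(\<xi>, j). S w \<xi> j) (\<Xi> \<times> {1..M}), restrict (b w) {..<n})"

text \<open>The splits that can occur. This set is countable, and each of its members satisfies the combinatorial
  constraints, so that it can be treated as a deterministic split.\<close>

definition draws :: "random_split set" where
  "draws = {(I, s, \<beta>). I \<subseteq> {..<n} \<and> card I = m \<and> s \<in> extensional (\<Xi> \<times> {1..M}) \<and>
     (\<forall>\<xi>\<in>\<Xi>. \<forall>j\<in>{1..M}. s (\<xi>, j) \<subseteq> {..<n} - I \<and> card (s (\<xi>, j)) = sz \<xi>) \<and>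
     \<beta> \<in> extensional {..<n} \<and>
     (cen = MOM \<longrightarrow> balanced_batches (num_batches A n \<Xi>) I \<beta>)}"

lemma draw_in_draws: "w \<in> space \<Omega> \<Longrightarrow> draw w \<in> draws"
proof -
  assume w: "w \<in> space \<Omega>"
  have "balanced_batches B (T w) (restrict (b w) {..<n}) = balanced_batches B (T w) (b w)" for B
    by (rule balanced_batches_cong) (use test(1)[OF w] in auto)
  then show ?thesis
    using test[OF w] subsets[OF w] batches[OF _ w] by (simp add: draw_def draws_def)
qed

lemma countable_draws: "countable draws"
proof (rule countable_subset)
  show "draws \<subseteq> Pow {..<n} \<times> (\<Xi> \<times> {1..M} \<rightarrow>\<^sub>E Pow {..<n}) \<times> ({..<n} \<rightarrow>\<^sub>E UNIV)"
  proof
    fix v assume "v \<in> draws"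
    then obtain I s \<beta> where v: "v = (I, s, \<beta>)" "I \<subseteq> {..<n}" "s \<in> extensional (\<Xi> \<times> {1..M})"
        "\<beta> \<in> extensional {..<n}" "\<And>\<xi> j. \<xi> \<in> \<Xi> \<Longrightarrow> j \<in> {1..M} \<Longrightarrow> s (\<xi>, j) \<subseteq> {..<n} - I"
      by (auto simp: draws_def)
    have "s z \<subseteq> {..<n}" if "z \<in> \<Xi> \<times> {1..M}" for z
      using v(5)[of "fst z" "snd z"] that by auto
    then show "v \<in> Pow {..<n} \<times> (\<Xi> \<times> {1..M} \<rightarrow>\<^sub>E Pow {..<n}) \<times> ({..<n} \<rightarrow>\<^sub>E UNIV)"
      using v(1-4) by (simp add: PiE_iff)
  qed
  show "countable (Pow {..<n} \<times> (\<Xi> \<times> {1..M} \<rightarrow>\<^sub>E Pow {..<n}) \<times> ({..<n} \<rightarrow>\<^sub>E (UNIV :: nat set)))"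
    using finite_candidates by (intro countable_SIGMA countable_PiE) (auto simp: countable_finite)
qed

lemma sets_iid_law: "sets (iid_law P n) = sets (PiM {..<n} (\<lambda>_. obs_space p))"
  unfolding iid_law_def by (rule sets_PiM_P)

lemma Z_space: "w \<in> space \<Omega> \<Longrightarrow> Z w \<in> space (iid_law P n)"
  using indep sets_eq_imp_space_eq[OF sets_iid_law] by (auto simp: indep_rvs_def dest: measurable_space)

lemma draw_event:
  assumes E: "\<And>v. v \<in> draws \<Longrightarrow> E v \<in> sets (iid_law P n)"
  shows "{w \<in> space \<Omega>. Z w \<in> E (draw w)} \<in> sets \<Omega>"
    and "0 \<le> \<delta> \<Longrightarrow> (\<And>v. v \<in> draws \<Longrightarrow> measure (iid_law P n) (E v) \<le> \<delta>) \<Longrightarrow>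
      measure \<Omega> {w \<in> space \<Omega>. Z w \<in> E (draw w)} \<le> \<delta>"
proof -
  have ind: "indep_rvs \<Omega> (PiM {..<n} (\<lambda>_. obs_space p)) Z (count_space UNIV) draw"
    using indep by (simp add: draw_def[abs_def])
  have E': "\<And>v. v \<in> draws \<Longrightarrow> E v \<in> sets (PiM {..<n} (\<lambda>_. obs_space p))"
    using E by (simp add: sets_iid_law)
  show "{w \<in> space \<Omega>. Z w \<in> E (draw w)} \<in> sets \<Omega>"
    by (rule W.indep_rvs_event_le(1)[OF ind countable_draws draw_in_draws E'])
  show "0 \<le> \<delta> \<Longrightarrow> (\<And>v. v \<in> draws \<Longrightarrow> measure (iid_law P n) (E v) \<le> \<delta>) \<Longrightarrow>
      measure \<Omega> {w \<in> space \<Omega>. Z w \<in> E (draw w)} \<le> \<delta>"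
    using W.indep_rvs_event_le(2)[OF ind countable_draws draw_in_draws, of E, OF _ E'] by (simp add: law)
qed

lemma fhat_draw:
  assumes "w \<in> space \<Omega>" "\<xi> \<in> \<Xi>"
  shows "fhat w \<xi> = average_predictor ft p M (Z w) (\<lambda>j. fst (snd (draw w)) (\<xi>, j))"
  unfolding fhat_def draw_def by (rule average_predictor_cong) (use assms in auto)

lemma draws_finite: "(I, s, \<beta>) \<in> draws \<Longrightarrow> \<xi> \<in> \<Xi> \<Longrightarrow> j \<in> {1..M} \<Longrightarrow> s (\<xi>, j) \<subseteq> {..<n} \<and> finite (s (\<xi>, j))"
proof -
  assume "(I, s, \<beta>) \<in> draws" "\<xi> \<in> \<Xi>" "j \<in> {1..M}"
  then have "s (\<xi>, j) \<subseteq> {..<n} - I" unfolding draws_def by blast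
  then have "s (\<xi>, j) \<subseteq> {..<n}" by blast
  then show ?thesis using finite_subset by blast
qed

lemma draws_predictor_measurable:
  assumes "(I, s, \<beta>) \<in> draws" "\<xi> \<in> \<Xi>"
  shows "(\<lambda>(D, x). average_predictor ft p M D (\<lambda>j. s (\<xi>, j)) x)
    \<in> borel_measurable (iid_law P n \<Otimes>\<^sub>M feature_space p)"
  using measurable_average_predictor[OF ft, of M "\<lambda>j. s (\<xi>, j)" "{..<n}" p] draws_finite[OF assms]
  by (subst measurable_cong_sets[OF sets_pair_measure_cong[OF sets_iid_law refl] refl]) auto

text \<open>Applied to the norm and to its ratio to the risk, this turns the stochastic boundedness in the
  hypotheses into a statement about genuine events.\<close>

lemma SUP_measurable_event:
  fixes g :: "(feature \<Rightarrow> real) \<Rightarrow> ennreal" and a :: ennreal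
  assumes g: "\<And>N F. (\<lambda>(D, x). F D x) \<in> borel_measurable (N \<Otimes>\<^sub>M feature_space p) \<Longrightarrow>
      (\<lambda>D :: nat \<Rightarrow> obs. g (F D)) \<in> borel_measurable N"
  shows "{w \<in> space \<Omega>. a < (SUP \<xi>\<in>\<Xi>. g (fhat w \<xi>))} \<in> sets \<Omega>"
proof -
  define E where "E = (\<lambda>v :: random_split. {D \<in> space (iid_law P n).
    a < (SUP \<xi>\<in>\<Xi>. g (average_predictor ft p M D (\<lambda>j. fst (snd v) (\<xi>, j))))})"
  have "E v \<in> sets (iid_law P n)" if v: "v \<in> draws" for v
  proof -
    obtain I s \<beta> where [simp]: "v = (I, s, \<beta>)" by (cases v)
    have "(\<lambda>D. g (average_predictor ft p M D (\<lambda>j. s (\<xi>, j)))) \<in> borel_measurable (iid_law P n)" if "\<xi> \<in> \<Xi>" for \<xi>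
      by (rule g) (rule draws_predictor_measurable, use v that in auto)
    then have "(\<lambda>D. SUP \<xi>\<in>\<Xi>. g (average_predictor ft p M D (\<lambda>j. s (\<xi>, j)))) \<in> borel_measurable (iid_law P n)"
      using finite_candidates by (intro borel_measurable_SUP) (auto simp: countable_finite)
    then show ?thesis unfolding E_def by simp
  qed
  from draw_event(1)[OF this]
  have "{w \<in> space \<Omega>. Z w \<in> E (draw w)} \<in> sets \<Omega>" .
  also have "{w \<in> space \<Omega>. Z w \<in> E (draw w)} = {w \<in> space \<Omega>. a < (SUP \<xi>\<in>\<Xi>. g (fhat w \<xi>))}"
    using Z_space by (auto simp: E_def fhat_draw cong: SUP_cong)
  finally show ?thesis .
qed

lemma fhat_measurable:
  assumes "w \<in> space \<Omega>" "\<xi> \<in> \<Xi>"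
  shows "fhat w \<xi> \<in> borel_measurable (feature_space p)"
proof -
  obtain I s \<beta> where v: "draw w = (I, s, \<beta>)" by (cases "draw w")
  have "(I, s, \<beta>) \<in> draws" using draw_in_draws[OF assms(1)] v by simp
  then show ?thesis
    using measurable_section[OF draws_predictor_measurable[OF _ assms(2)] Z_space[OF assms(1)]]
    unfolding fhat_draw[OF assms] v by simp
qed

text \<open>The norm bound is part of the event because the threshold is only meaningful under it; on the
  event where all norms are bounded it is satisfied anyway.\<close>

definition deviates :: "real \<Rightarrow> 'w \<Rightarrow> nat \<Rightarrow> bool" where
  "deviates C w \<xi> \<longleftrightarrow> loss_norm nk l P (fhat w \<xi>) < ennreal (C * (1 + fit_risk w \<xi>)) \<and>
     blocks_deviate l (Z w) (T w) (if cen = AVG then 1 else num_batches A n \<Xi>)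
       (if cen = AVG then (\<lambda>_. 0) else b w) (fhat w \<xi>) (fit_risk w \<xi>)
       (C * (1 + fit_risk w \<xi>) * deviation_rate A n m)"

lemma deviation_probability:
  assumes n: "n \<ge> 3" and X: "1 \<le> card \<Xi>" "card \<Xi> \<le> n" and A: "A > 0" and m: "m > 0"
    and t: "deviation_rate A n m \<le> 8" and cen: "cen = AVG \<Longrightarrow> nk = Psi1"
  shows "{w \<in> space \<Omega>. \<exists>\<xi>\<in>\<Xi>. deviates C w \<xi>} \<in> sets \<Omega>"
    and "measure \<Omega> {w \<in> space \<Omega>. \<exists>\<xi>\<in>\<Xi>. deviates C w \<xi>} \<le> 2 / real n + real n powr (- A)"
proof -
  interpret iid: prob_space "iid_law P n" unfolding iid_law_def by (rule product_measure_prob_space)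
  define \<delta> where "\<delta> = (2 / real n + real n powr (- A)) / real (card \<Xi>)"
  have \<delta>: "0 \<le> \<delta>" by (simp add: \<delta>_def)
  define G where "G = (\<lambda>(v :: random_split) (\<xi> :: nat). {D \<in> space (iid_law P n). 
    let f = average_predictor ft p M D (\<lambda>j. fst (snd v) (\<xi>, j));
        c = C * (1 + enn2real (risk l P f)) in
     loss_norm nk l P f < ennreal c \<and>
     blocks_deviate l D (fst v) (if cen = AVG then 1 else num_batches A n \<Xi>)
       (if cen = AVG then (\<lambda>_. 0) else snd (snd v)) f (enn2real (risk l P f)) (c * deviation_rate A n m)})"
  have G: "G v \<xi> \<in> sets (iid_law P n)" "measure (iid_law P n) (G v \<xi>) \<le> \<delta>" if v: "v \<in> draws" and \<xi>: "\<xi> \<in> \<Xi>" for v \<xi>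
  proof -
    obtain I s \<beta> where v_eq: "v = (I, s, \<beta>)" by (cases v)
    have I: "I \<subseteq> {..<n}" "card I = m" and s: "\<And>j. j \<in> {1..M} \<Longrightarrow> s (\<xi>, j) \<subseteq> {..<n} - I"
      using v \<xi> by (auto simp: v_eq draws_def)
    have bal: "cen = MOM \<Longrightarrow> balanced_batches (num_batches A n \<Xi>) I \<beta>"
      using v unfolding v_eq draws_def by blast
    have fI: "finite I" using I(1) by (rule finite_subset) simp
    note dev = empirical_risk_deviation[OF n X A fI _ _ cen bal, unfolded I(2), OF m t, folded \<delta>_def]
    note * = predictor_deviation[where nk = nk and B = "if cen = AVG then 1 else num_batches A n \<Xi>"
        and b = "if cen = AVG then (\<lambda>_. 0) else \<beta>" and t = "deviation_rate A n m" and C = C,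
        OF ft I(1) s \<delta> dev]
    show "G v \<xi> \<in> sets (iid_law P n)" "measure (iid_law P n) (G v \<xi>) \<le> \<delta>"
      unfolding G_def v_eq Let_def fst_conv snd_conv by (rule *; assumption)+
  qed
  define E where "E = (\<lambda>v :: random_split. \<Union>\<xi>\<in>\<Xi>. G v \<xi>)"
  have E: "E v \<in> sets (iid_law P n)" "measure (iid_law P n) (E v) \<le> 2 / real n + real n powr (- A)" if v: "v \<in> draws" for v
  proof -
    show "E v \<in> sets (iid_law P n)" unfolding E_def using G(1)[OF v] finite_candidates by auto
    have "measure (iid_law P n) (E v) \<le> (\<Sum>\<xi>\<in>\<Xi>. measure (iid_law P n) (G v \<xi>))"
      unfolding E_def using G(1)[OF v] finite_candidates by (intro iid.finite_measure_subadditive_finite) auto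
    also have "\<dots> \<le> (\<Sum>\<xi>\<in>\<Xi>. \<delta>)" by (intro sum_mono G(2)[OF v])
    also have "\<dots> = 2 / real n + real n powr (- A)" using X by (simp add: \<delta>_def)
    finally show "measure (iid_law P n) (E v) \<le> 2 / real n + real n powr (- A)" .
  qed
  have "Z w \<in> G (draw w) \<xi> \<longleftrightarrow> deviates C w \<xi>" if w: "w \<in> space \<Omega>" and \<xi>: "\<xi> \<in> \<Xi>" for w \<xi>
  proof -
    have "blocks_deviate l (Z w) (T w) B (restrict (b w) {..<n}) f x r = blocks_deviate l (Z w) (T w) B (b w) f x r"
      for B f x r by (rule blocks_deviate_batch_cong) (use test(1)[OF w] in auto)
    then show ?thesis
      using Z_space[OF w] unfolding G_def deviates_def fit_risk_def fhat_draw[OF w \<xi>]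
      by (auto simp: Let_def draw_def)
  qed
  then have eq: "{w \<in> space \<Omega>. Z w \<in> E (draw w)} = {w \<in> space \<Omega>. \<exists>\<xi>\<in>\<Xi>. deviates C w \<xi>}"
    by (auto simp: E_def)
  show "{w \<in> space \<Omega>. \<exists>\<xi>\<in>\<Xi>. deviates C w \<xi>} \<in> sets \<Omega>"
    using draw_event(1)[where E = E, OF E(1)] by (simp add: eq)
  show "measure \<Omega> {w \<in> space \<Omega>. \<exists>\<xi>\<in>\<Xi>. deviates C w \<xi>} \<le> 2 / real n + real n powr (- A)"
    using draw_event(2)[where E = E, OF E(1) _ E(2)] by (simp add: eq)
qed

text \<open>The exceptional event is that one of the \<open>M\<close> subsamples yields a predictor of risk above \<open>a\<close>. For a fixed
  split each subsample has the law of an i.i.d. dataset of its size.\<close>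

lemma reference_probability:
  fixes a :: ennreal
  assumes M: "M \<ge> 1" and \<xi>: "\<xi> \<in> \<Xi>"
  defines "q \<equiv> measure (iid_law P (sz \<xi>)) {D \<in> space (iid_law P (sz \<xi>)). a < risk l P (ft p (dataset D {..<sz \<xi>}))}"
  shows "\<exists>B\<in>sets \<Omega>. measure \<Omega> B \<le> real M * q \<and> (\<forall>w\<in>space \<Omega> - B. risk l P (fhat w \<xi>) \<le> a)"
proof -
  interpret iid: prob_space "iid_law P n" unfolding iid_law_def by (rule product_measure_prob_space)
  define E where "E = (\<lambda>v :: random_split. \<Union>j\<in>{1..M}. {D \<in> space (iid_law P n).
     a < risk l P (ft p (dataset D (fst (snd v) (\<xi>, j))))})"
  have E: "E v \<in> sets (iid_law P n)" "measure (iid_law P n) (E v) \<le> real M * q" if v: "v \<in> draws" for v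
  proof -
    obtain I s \<beta> where v_eq: "v = (I, s, \<beta>)" by (cases v)
    have s: "s (\<xi>, j) \<subseteq> {..<n}" "card (s (\<xi>, j)) = sz \<xi>" if "j \<in> {1..M}" for j
      using v \<xi> that draws_finite[of I s \<beta> \<xi> j] unfolding v_eq by (blast, simp add: draws_def)
    let ?E = "\<lambda>j. {D \<in> space (iid_law P n). a < risk l P (ft p (dataset D (s (\<xi>, j))))}"
    have sets: "?E j \<in> sets (iid_law P n)" if "j \<in> {1..M}" for j
      using dataset_risk_measurable[OF ft s(1)[OF that]] by measurable
    show "E v \<in> sets (iid_law P n)" unfolding E_def v_eq using sets by auto
    have "measure (iid_law P n) (E v) \<le> (\<Sum>j\<in>{1..M}. measure (iid_law P n) (?E j))"
      unfolding E_def v_eq fst_conv snd_conv using sets by (intro iid.finite_measure_subadditive_finite) auto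
    also have "\<dots> = (\<Sum>j\<in>{1..M}. q)"
      by (intro sum.cong refl) (simp only: subset_risk_law[OF ft s(1)] s(2) q_def)
    finally show "measure (iid_law P n) (E v) \<le> real M * q" by simp
  qed
  let ?B = "{w \<in> space \<Omega>. Z w \<in> E (draw w)}"
  show ?thesis
  proof (intro bexI[of _ ?B] conjI ballI)
    show "?B \<in> sets \<Omega>" by (rule draw_event(1)[where E = E, OF E(1)])
    show "measure \<Omega> ?B \<le> real M * q" by (rule draw_event(2)[where E = E, OF E(1) _ E(2)]) (auto simp: q_def)
    fix w assume w: "w \<in> space \<Omega> - ?B"
    then have ws: "w \<in> space \<Omega>" by simp
    have sub: "S w \<xi> j \<subseteq> {..<n}" if "j \<in> {1..M}" for j using subsets(1)[OF ws \<xi> that] by auto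
    show "risk l P (fhat w \<xi>) \<le> a"
      unfolding fhat_def
    proof (rule risk_average_le[OF convex M])
      fix j assume j: "j \<in> {1..M}"
      have "Z w \<in> space (PiM {..<n} (\<lambda>_. obs_space p))"
        using Z_space[OF ws] sets_eq_imp_space_eq[OF sets_iid_law] by simp
      then show "ft p (dataset (Z w) (S w \<xi> j)) \<in> borel_measurable (feature_space p)"
        using measurable_section[OF measurable_procedure_dataset[OF ft sub[OF j] finite_subset[OF sub[OF j]]]] by simp
      have "\<not> a < risk l P (ft p (dataset (Z w) (S w \<xi> j)))"
        using w Z_space[OF ws] j \<xi> unfolding E_def draw_def by force
      then show "risk l P (ft p (dataset (Z w) (S w \<xi> j))) \<le> a" by simp
    qed
  qed
qed

text \<open>The chain \<open>R(selected) \<lesssim> empirical risk of selected \<le> empirical risk of reference \<lesssim> R(reference)\<close>, with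
  multiplicative and additive errors \<open>\<tau>\<close>. The smallness condition on \<open>\<tau>\<close> is what absorbs them into half
  of \<open>e\<close>, the other half being the error at the reference point.\<close>

lemma selected_risk_le:
  assumes w: "w \<in> space \<Omega>" and \<xi>0: "\<xi>0 \<in> \<Xi>"
    and min: "is_arg_min (\<lambda>\<xi>. empirical_risk cen l (Z w) (T w) (num_batches A n \<Xi>) (b w) (fhat w \<xi>))
        (\<lambda>\<xi>. \<xi> \<in> \<Xi>) \<xi>h"
    and norm: "\<And>\<xi>. \<xi> \<in> \<Xi> \<Longrightarrow> loss_norm nk l P (fhat w \<xi>) < ennreal (C * (1 + fit_risk w \<xi>))"
    and dev: "\<And>\<xi>. \<xi> \<in> \<Xi> \<Longrightarrow> \<not> deviates C w \<xi>"
    and r: "0 \<le> r" "0 < e" and base: "risk l P (fhat w \<xi>0) \<le> ennreal (r + e / 2)"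
    and \<tau>: "C * deviation_rate A n m * (2 * r + 3 * e / 2 + 2) \<le> e / 2"
    and C: "0 \<le> C" and B: "0 < num_batches A n \<Xi>"
  shows "risk l P (fhat w \<xi>h) \<le> ennreal (r + e)"
proof -
  let ?emp = "\<lambda>\<xi>. empirical_risk cen l (Z w) (T w) (num_batches A n \<Xi>) (b w) (fhat w \<xi>)"
  define \<tau> where "\<tau> = C * deviation_rate A n m"
  have \<xi>h: "\<xi>h \<in> \<Xi>" "?emp \<xi>h \<le> ?emp \<xi>0" using min \<xi>0 by (auto simp: is_arg_min_def not_less)
  have close: "\<bar>?emp \<xi> - fit_risk w \<xi>\<bar> \<le> \<tau> * (1 + fit_risk w \<xi>)" if "\<xi> \<in> \<Xi>" for \<xi>
  proof -
    have "\<bar>?emp \<xi> - fit_risk w \<xi>\<bar> \<le> C * (1 + fit_risk w \<xi>) * deviation_rate A n m"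
      by (rule empirical_risk_within[OF B]) (use dev[OF that] norm[OF that] in \<open>simp add: deviates_def\<close>)
    then show ?thesis by (simp add: \<tau>_def mult_ac)
  qed
  have risk: "risk l P (fhat w \<xi>) = ennreal (fit_risk w \<xi>)" if "\<xi> \<in> \<Xi>" for \<xi>
    using loss_norm_lessD(6)[OF fhat_measurable[OF w that] norm[OF that]] by (simp add: fit_risk_def)
  define x y where "x = fit_risk w \<xi>h" and "y = fit_risk w \<xi>0"
  have xy: "0 \<le> x" "0 \<le> y" by (simp_all add: x_def y_def fit_risk_def)
  have y: "y \<le> r + e / 2" using base r unfolding risk[OF \<xi>0] y_def by (subst (asm) ennreal_le_iff) auto
  have \<tau>e: "\<tau> * (2 * r + 3 * e / 2 + 2) \<le> e / 2" using \<tau> by (simp add: \<tau>_def)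
  \<comment> \<open>Needed to divide by \<open>1 - \<tau>\<close>, the coefficient of the selected risk.\<close>
  have "\<tau> < 1"
  proof (rule ccontr)
    assume "\<not> \<tau> < 1"
    define Q where "Q = 2 * r + 3 * e / 2 + 2"
    have "0 \<le> Q" using r by (simp add: Q_def)
    then have "1 * Q \<le> \<tau> * Q" using \<open>\<not> \<tau> < 1\<close> by (intro mult_right_mono) auto
    moreover have "\<tau> * Q \<le> e / 2" using \<tau>e by (simp only: Q_def)
    ultimately have "Q \<le> e / 2" by simp
    then show False using r by (simp add: Q_def)
  qed
  have \<tau>0: "0 \<le> \<tau>"
  proof -
    have "0 \<le> \<tau> * (1 + y)" using close[OF \<xi>0] by (auto simp: y_def)
    then show ?thesis using xy by (simp add: zero_le_mult_iff)
  qed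
  have chain: "x - \<tau> * (1 + x) \<le> y + \<tau> * (1 + y)"
    using close[OF \<xi>h(1)] close[OF \<xi>0] \<xi>h(2) by (simp add: x_def y_def abs_le_iff)
  have "x \<le> r + e"
  proof (rule ccontr)
    assume "\<not> x \<le> r + e"
    then have "(1 - \<tau>) * (r + e) < (1 - \<tau>) * x" using \<open>\<tau> < 1\<close> by (intro mult_strict_left_mono) auto
    also have "\<dots> \<le> (1 + \<tau>) * y + 2 * \<tau>" using chain by (simp add: algebra_simps)
    also have "\<dots> \<le> (1 + \<tau>) * (r + e / 2) + 2 * \<tau>" using y \<tau>0 by (intro add_right_mono mult_left_mono) auto
    finally show False using \<tau>e by (simp add: field_simps)
  qed
  then show ?thesis using risk[OF \<xi>h(1)] by (simp add: x_def ennreal_leI)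
qed

end

section \<open>Consistency of the zero-step procedure\<close>

theorem theorem3p11:
  fixes \<gamma> \<nu> A :: real
    and M :: nat
    and p nte :: "nat \<Rightarrow> nat"
    and l :: "real \<Rightarrow> real \<Rightarrow> real"
    and ft :: procedure
    and Rdet :: "ennreal \<Rightarrow> ennreal"
    and P :: "nat \<Rightarrow> obs measure"
    and \<Omega> :: "nat \<Rightarrow> 'w measure"
    and Z :: "nat \<Rightarrow> 'w \<Rightarrow> nat \<Rightarrow> obs"
    and T :: "nat \<Rightarrow> 'w \<Rightarrow> nat set"
    and S :: "nat \<Rightarrow> 'w \<Rightarrow> nat \<Rightarrow> nat \<Rightarrow> nat set"
    and b :: "nat \<Rightarrow> 'w \<Rightarrow> nat \<Rightarrow> nat"
    and \<xi>hat :: "nat \<Rightarrow> 'w \<Rightarrow> nat"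
    and cen :: centering
    and nk :: norm_kind
    and \<Xi> :: "nat \<Rightarrow> nat set"
    and fhat :: "nat \<Rightarrow> 'w \<Rightarrow> nat \<Rightarrow> feature \<Rightarrow> real"
    and \<sigma>\<Xi> \<kappa>\<Xi> :: "nat \<Rightarrow> 'w \<Rightarrow> ennreal"
  defines "\<Xi> \<equiv> \<lambda>n. grid \<nu> n (nte n)"
    and "fhat \<equiv> \<lambda>n w \<xi>. average_predictor ft (p n) M (Z n w) (S n w \<xi>)"
    and "\<sigma>\<Xi> \<equiv> \<lambda>n w. SUP \<xi>\<in>\<Xi> n. loss_norm nk l (P n) (fhat n w \<xi>)"
    and "\<kappa>\<Xi> \<equiv> \<lambda>n w. SUP \<xi>\<in>\<Xi> n. norm_ratio nk l (P n) (fhat n w \<xi>)"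
  \<comment> \<open>distributions, loss and procedure\<close>
  assumes "\<gamma> > 0" and "(\<lambda>n. real (p n) / real n) \<longlonglongrightarrow> \<gamma>"
    and "\<And>n. prob_space (P n)" and "\<And>n. sets (P n) = sets (obs_space (p n))"
    and "\<And>y z. 0 \<le> l y z" and "\<And>y. convex_on UNIV (l y)"
    and "(\<lambda>(y, z). l y z) \<in> borel_measurable (borel \<Otimes>\<^sub>M borel)"
    and "measurable_procedure ft"
  \<comment> \<open>the deterministic risk profile\<close>
    and "proper_on {ennreal \<gamma>..} Rdet" and "lower_semicontinuous_on {ennreal \<gamma>..} Rdet"
    and cond_a: "\<And>N k \<phi>. \<phi> \<in> minimizers \<gamma> Rdet \<Longrightarrow> proportional p N k \<phi> \<Longrightarrow>
          \<exists>c>0. \<forall>\<^sub>F m in sequentially. AE D in iid_law (P (N m)) (k m).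
            ennreal c \<le> risk l (P (N m)) (ft (p (N m)) (dataset D {..<k m}))"
    and cond_b: "\<And>N k \<phi>. \<phi> \<in> minimizers \<gamma> Rdet \<Longrightarrow> proportional p N k \<phi> \<Longrightarrow>
          tendsto_in_prob (\<lambda>m. iid_law (P (N m)) (k m))
            (\<lambda>m D. risk l (P (N m)) (ft (p (N m)) (dataset D {..<k m}))) (Rdet \<phi>)"
    and cond_c: "\<And>\<phi>. \<phi> \<in> minimizers \<gamma> Rdet \<Longrightarrow> continuous (at \<phi> within {ennreal \<gamma>..}) Rdet"
  \<comment> \<open>the zero-step procedure\<close>
    and "0 < \<nu>" "\<nu> < 1" and "M \<ge> 1" and "A > 0"
    and "\<forall>\<^sub>F n in sequentially. 0 < nte n \<and> nte n < n"
    and "(\<lambda>n. real (nte n) / real n) \<longlonglongrightarrow> 0" and "(\<lambda>n. ln (real n) / real (nte n)) \<longlonglongrightarrow> 0"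
    and "\<And>n. prob_space (\<Omega> n)"
    and "\<And>n. distr (\<Omega> n) (PiM {..<n} (\<lambda>_. obs_space (p n))) (Z n) = iid_law (P n) n"
    and "\<And>n. indep_rvs (\<Omega> n)
          (PiM {..<n} (\<lambda>_. obs_space (p n))) (Z n)
          (count_space UNIV) (\<lambda>w. (T n w, restrict (\<lambda>(\<xi>, j). S n w \<xi> j) (\<Xi> n \<times> {1..M}),
                                    restrict (b n w) {..<n}))"
    and "\<forall>\<^sub>F n in sequentially.
          random_draws (\<Omega> n) n (nte n) (\<Xi> n) (sub_size \<nu> n (nte n)) M (T n) (S n)"
    and "cen = MOM \<Longrightarrow> \<forall>\<^sub>F n in sequentially. \<forall>w\<in>space (\<Omega> n).
          balanced_batches (num_batches A n (\<Xi> n)) (T n w) (b n w)"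
    and "\<And>n. \<xi>hat n \<in> measurable (\<Omega> n) (count_space UNIV)"
    and "\<forall>\<^sub>F n in sequentially. \<forall>w\<in>space (\<Omega> n).
          is_arg_min
            (\<lambda>\<xi>. empirical_risk cen l (Z n w) (T n w) (num_batches A n (\<Xi> n)) (b n w) (fhat n w \<xi>))
            (\<lambda>\<xi>. \<xi> \<in> \<Xi> n) (\<xi>hat n w)"
  \<comment> \<open>the two alternatives of (d)\<close>
    and "cen = AVG \<Longrightarrow> nk = Psi1"
    and cond_d: "(big_O_p \<Omega> \<sigma>\<Xi> \<and>
           (\<lambda>n. (INF \<xi>\<in>\<Xi> n. Rdet (ennreal (real (p n) / real (sub_size \<nu> n (nte n) \<xi>))))
                  * ennreal (sqrt (real (nte n) / ln (real n)))) \<longlonglongrightarrow> \<infinity>)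
         \<or> big_O_p \<Omega> \<kappa>\<Xi>"
  shows "small_o_p \<Omega> (\<lambda>n w. risk l (P n) (fhat n w (\<xi>hat n w)) - (INF \<zeta>\<in>{ennreal \<gamma>..}. Rdet \<zeta>))"
proof -
  let ?r = "INF \<zeta>\<in>{ennreal \<gamma>..}. Rdet \<zeta>"
  obtain z where z: "z \<in> minimizers \<gamma> Rdet" "ennreal \<gamma> \<le> z" "Rdet z = ?r" "Rdet z < \<infinity>"
    by (rule minimizer_exists[OF assms(13,14)])
  define r where "r = enn2real ?r"
  have r: "?r = ennreal r" "0 \<le> r" using z(3,4) by (auto simp: r_def less_top)
  obtain \<xi> where \<xi>: "\<forall>\<^sub>F n in sequentially. \<xi> n \<in> grid \<nu> n (nte n)"
    and regime: "proportional p (\<lambda>n. n) (\<lambda>n. sub_size \<nu> n (nte n) (\<xi> n)) z"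
    by (rule reference_subsample_sizes[OF assms(5,6) z(2) assms(18,19,22,23)])
  define k where "k = (\<lambda>n. sub_size \<nu> n (nte n) (\<xi> n))"
  have model: "loss_model (P n) (p n) l" for n
    by (intro loss_model.intro loss_model_axioms.intro assms(7-9,11))
  \<comment> \<open>The fixed-size results apply to all large sample sizes.\<close>
  have sample: "\<forall>\<^sub>F n in sequentially. zero_step_sample (P n) (p n) l (\<Omega> n) ft n (nte n) M (\<Xi> n)
      (sub_size \<nu> n (nte n)) cen A (Z n) (T n) (S n) (b n)"
  proof -
    have "\<forall>\<^sub>F n in sequentially. cen = MOM \<longrightarrow>
        (\<forall>w\<in>space (\<Omega> n). balanced_batches (num_batches A n (\<Xi> n)) (T n w) (b n w))"
      using assms(29) by (cases cen) auto
    with assms(28) show ?thesis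
    proof eventually_elim
      case (elim n)
      show ?case
      proof (intro zero_step_sample.intro zero_step_sample_axioms.intro model assms(12,10,25,26,27))
        show "finite (\<Xi> n)" unfolding \<Xi>_def by (rule finite_grid)
      qed (use elim in \<open>auto simp: random_draws_def\<close>)
    qed
  qed
  have fhat_eq: "zero_step_sample.fhat (p n) ft M (Z n) (S n) w \<xi>' = fhat n w \<xi>'"
    if "zero_step_sample (P n) (p n) l (\<Omega> n) ft n (nte n) M (\<Xi> n)
      (sub_size \<nu> n (nte n)) cen A (Z n) (T n) (S n) (b n)" for n w \<xi>'
    unfolding zero_step_sample.fhat_def[OF that] fhat_def ..
  \<comment> \<open>Both alternatives of the last hypothesis give, off an event of small probability, the same bound
    on all norms at once: a constant times one plus the risk.\<close>
  have norms_of: "\<exists>C B. 0 \<le> C \<and> (\<forall>\<^sub>F n in sequentially. B n \<in> sets (\<Omega> n) \<and> measure (\<Omega> n) (B n) \<le> \<eta> \<and>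
      (\<forall>w\<in>space (\<Omega> n) - B n. \<forall>\<xi>\<in>\<Xi> n. loss_norm nk l (P n) (fhat n w \<xi>)
          < ennreal (C * (1 + enn2real (risk l (P n) (fhat n w \<xi>))))))"
    if \<eta>: "\<eta> > 0" and O: "big_O_p \<Omega> (\<lambda>n w. SUP \<xi>\<in>\<Xi> n. g n (fhat n w \<xi>))"
      and g: "\<And>n (N :: (nat \<Rightarrow> obs) measure) F. (\<lambda>(D, x). F D x) \<in> borel_measurable (N \<Otimes>\<^sub>M feature_space (p n)) \<Longrightarrow>
        (\<lambda>D. g n (F D)) \<in> borel_measurable N"
      and bound: "\<And>n f C. f \<in> borel_measurable (feature_space (p n)) \<Longrightarrow> g n f \<le> ennreal C \<Longrightarrow> 0 \<le> C \<Longrightarrow>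
        loss_norm nk l (P n) f < ennreal ((C + 1) * (1 + enn2real (risk l (P n) f)))"
    for \<eta> and g :: "nat \<Rightarrow> (feature \<Rightarrow> real) \<Rightarrow> ennreal"
  proof -
    obtain C where C: "\<forall>\<^sub>F n in sequentially.
        measure (\<Omega> n) {w \<in> space (\<Omega> n). ennreal C < (SUP \<xi>\<in>\<Xi> n. g n (fhat n w \<xi>))} \<le> \<eta>"
      using \<eta> O by (auto simp: big_O_p_def)
    let ?B = "\<lambda>n. {w \<in> space (\<Omega> n). ennreal C < (SUP \<xi>\<in>\<Xi> n. g n (fhat n w \<xi>))}"
    show ?thesis
    proof (intro exI[of _ "max C 0 + 1"] exI[of _ ?B] conjI)
      show "\<forall>\<^sub>F n in sequentially. ?B n \<in> sets (\<Omega> n) \<and> measure (\<Omega> n) (?B n) \<le> \<eta> \<and>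
      (\<forall>w\<in>space (\<Omega> n) - ?B n. \<forall>\<xi>\<in>\<Xi> n. loss_norm nk l (P n) (fhat n w \<xi>)
          < ennreal ((max C 0 + 1) * (1 + enn2real (risk l (P n) (fhat n w \<xi>)))))"
        using sample C
      proof eventually_elim
        case (elim n)
        interpret s: zero_step_sample "P n" "p n" l "\<Omega> n" ft n "nte n" M "\<Xi> n" "sub_size \<nu> n (nte n)"
          cen nk A "Z n" "T n" "S n" "b n" by (rule elim(1))
        have "?B n \<in> sets (\<Omega> n)"
          using s.SUP_measurable_event[where g = "g n" and a = "ennreal C", OF g]
          by (simp add: fhat_eq[OF elim(1)])
        moreover have "loss_norm nk l (P n) (fhat n w \<xi>)
            < ennreal ((max C 0 + 1) * (1 + enn2real (risk l (P n) (fhat n w \<xi>))))"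
          if w: "w \<in> space (\<Omega> n) - ?B n" and \<xi>: "\<xi> \<in> \<Xi> n" for w \<xi>
        proof (rule bound)
          show "fhat n w \<xi> \<in> borel_measurable (feature_space (p n))"
            using s.fhat_measurable[OF _ \<xi>, of w] w by (simp add: fhat_eq[OF elim(1)])
          have "g n (fhat n w \<xi>) \<le> (SUP \<xi>\<in>\<Xi> n. g n (fhat n w \<xi>))"
            using \<xi> by (rule SUP_upper)
          also have "\<dots> \<le> ennreal C" using w by (auto simp: not_less)
          also have "\<dots> \<le> ennreal (max C 0)" by (intro ennreal_leI) simp
          finally show "g n (fhat n w \<xi>) \<le> ennreal (max C 0)" .
        qed simp
        ultimately show ?case using elim(2) by blast
      qed
    qed simp
  qed
  have norms: "\<exists>C B. 0 \<le> C \<and> (\<forall>\<^sub>F n in sequentially. B n \<in> sets (\<Omega> n) \<and> measure (\<Omega> n) (B n) \<le> \<eta> \<and>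
      (\<forall>w\<in>space (\<Omega> n) - B n. \<forall>\<xi>\<in>\<Xi> n. loss_norm nk l (P n) (fhat n w \<xi>)
          < ennreal (C * (1 + enn2real (risk l (P n) (fhat n w \<xi>))))))"
    if \<eta>: "\<eta> > 0" for \<eta>
    using cond_d
  proof
    assume "big_O_p \<Omega> \<sigma>\<Xi> \<and> (\<lambda>n. (INF \<xi>\<in>\<Xi> n. Rdet (ennreal (real (p n) / real (sub_size \<nu> n (nte n) \<xi>))))
                  * ennreal (sqrt (real (nte n) / ln (real n)))) \<longlonglongrightarrow> \<infinity>"
    then show ?thesis
      unfolding \<sigma>\<Xi>_def
      by (intro norms_of[OF \<eta>, of "\<lambda>n. loss_norm nk l (P n)"] loss_model.loss_norm_measurable[OF model]
          loss_model.norm_lt_of_norm_le[OF model]) auto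
  next
    assume "big_O_p \<Omega> \<kappa>\<Xi>"
    then show ?thesis
      unfolding \<kappa>\<Xi>_def
      by (intro norms_of[OF \<eta>, of "\<lambda>n. norm_ratio nk l (P n)"] loss_model.norm_ratio_measurable[OF model]
          loss_model.norm_lt_of_ratio_le[OF model]) auto
  qed
  show ?thesis
    unfolding small_o_p_def
  proof (intro allI impI)
    fix e :: real assume e: "e > 0"
    \<comment> \<open>The failure probability of a single predictor at the reference point.\<close>
    define q where "q = (\<lambda>n. measure (iid_law (P n) (k n)) {D \<in> space (iid_law (P n) (k n)).
        ennreal (r + e / 2) < risk l (P n) (ft (p n) (dataset D {..<k n}))})"
    have above: "ennreal d < x - ennreal r \<longleftrightarrow> ennreal (r + d) < x" if "0 < d" for d x
      using that r(2) less_diff_eq_ennreal[of x "ennreal r" "ennreal d"]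
      by (simp add: add.commute)
    have q: "q \<longlonglongrightarrow> 0"
    proof (rule tendsto_sandwich[OF _ _ tendsto_const])
      let ?X = "\<lambda>n D. risk l (P n) (ft (p n) (dataset D {..<k n}))"
      let ?d = "\<lambda>n. measure (iid_law (P n) (k n)) {D \<in> space (iid_law (P n) (k n)).
          ennreal (e / 2) < (?X n D - ennreal r) + (ennreal r - ?X n D)}"
      show "?d \<longlonglongrightarrow> 0"
        using cond_b[OF z(1) regime] e unfolding tendsto_in_prob_def small_o_p_def k_def z(3) r(1)
        by (auto dest: spec[of _ "e / 2"])
      show "\<forall>\<^sub>F n in sequentially. q n \<le> ?d n"
      proof (rule always_eventually, rule allI)
        fix n
        interpret m: loss_model "P n" "p n" l by (rule model)
        interpret iid: prob_space "iid_law (P n) (k n)"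
          unfolding iid_law_def by (rule m.product_measure_prob_space)
        have [measurable]: "?X n \<in> borel_measurable (iid_law (P n) (k n))"
          by (rule m.dataset_risk_measurable[OF assms(12)]) simp
        show "q n \<le> ?d n" unfolding q_def
        proof (rule iid.finite_measure_mono)
          show "{D \<in> space (iid_law (P n) (k n)). ennreal (e / 2) < (?X n D - ennreal r) + (ennreal r - ?X n D)}
              \<in> sets (iid_law (P n) (k n))" by measurable
          show "{D \<in> space (iid_law (P n) (k n)). ennreal (r + e / 2) < ?X n D}
            \<subseteq> {D \<in> space (iid_law (P n) (k n)). ennreal (e / 2) < (?X n D - ennreal r) + (ennreal r - ?X n D)}"
            using above[of "e / 2"] e by (auto intro!: less_le_trans[OF _ add_increasing2[OF zero_le order_refl]])
        qed
      qed
    qed (simp add: q_def)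
    let ?bad = "\<lambda>n. {w \<in> space (\<Omega> n). ennreal e < risk l (P n) (fhat n w (\<xi>hat n w)) - ?r}"
    show "(\<lambda>n. measure (\<Omega> n) (?bad n)) \<longlonglongrightarrow> 0"
    proof (rule tendstoI)
      fix \<eta> :: real assume "\<eta> > 0"
      then have \<eta>: "\<eta> / 2 > 0" by simp
      obtain C B where C: "0 \<le> C" and B: "\<forall>\<^sub>F n in sequentially. B n \<in> sets (\<Omega> n) \<and> measure (\<Omega> n) (B n) \<le> \<eta> / 2 \<and>
          (\<forall>w\<in>space (\<Omega> n) - B n. \<forall>\<xi>\<in>\<Xi> n. loss_norm nk l (P n) (fhat n w \<xi>)
            < ennreal (C * (1 + enn2real (risk l (P n) (fhat n w \<xi>)))))"
        using norms[OF \<eta>] by blast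
      have rate: "(\<lambda>n. deviation_rate A n (nte n)) \<longlonglongrightarrow> 0"
        by (rule deviation_rate_tendsto_0[OF assms(24)])
      have rate8: "\<forall>\<^sub>F n in sequentially. deviation_rate A n (nte n) < 8"
        using rate by (rule order_tendstoD) simp
      have "(\<lambda>n. C * deviation_rate A n (nte n) * (2 * r + 3 * e / 2 + 2)) \<longlonglongrightarrow> C * 0 * (2 * r + 3 * e / 2 + 2)"
        by (intro tendsto_intros rate)
      then have small: "\<forall>\<^sub>F n in sequentially. C * deviation_rate A n (nte n) * (2 * r + 3 * e / 2 + 2) < e / 2"
        by (rule order_tendstoD) (use e in simp)
      have "(\<lambda>n. real n powr (- A)) \<longlonglongrightarrow> 0"
        by (rule tendsto_neg_powr[OF _ filterlim_real_sequentially]) (use assms(21) in simp)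
      then have "(\<lambda>n. (2 / real n + real n powr (- A)) + real M * q n) \<longlonglongrightarrow> (0 + 0) + real M * 0"
        by (intro tendsto_add tendsto_mult tendsto_const lim_const_over_n q)
      then have tail: "\<forall>\<^sub>F n in sequentially. (2 / real n + real n powr (- A)) + real M * q n < \<eta> / 2"
        by (rule order_tendstoD) (use \<eta> in simp)
      show "\<forall>\<^sub>F n in sequentially. dist (measure (\<Omega> n) (?bad n)) 0 < \<eta>"
        using sample B rate8 small tail \<xi> assms(22) assms(31) eventually_ge_at_top[of 3]
      proof eventually_elim
        case (elim n)
        interpret s: zero_step_sample "P n" "p n" l "\<Omega> n" ft n "nte n" M "\<Xi> n" "sub_size \<nu> n (nte n)"
          cen nk A "Z n" "T n" "S n" "b n" by (rule elim(1))
        note fhat = fhat_eq[OF elim(1)]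
        have \<xi>n: "\<xi> n \<in> \<Xi> n" using elim by (simp add: \<Xi>_def)
        have card: "1 \<le> card (\<Xi> n)" "card (\<Xi> n) \<le> n"
          using \<xi>n s.finite_candidates card_grid_le[of \<nu> n "nte n"] by (auto simp: Suc_le_eq card_gt_0_iff \<Xi>_def)
        have "nte n > 0" using elim by simp
        note dev = s.deviation_probability[OF elim(9) card assms(21) this less_imp_le[OF elim(3)] assms(32), of C]
        let ?Dev = "{w \<in> space (\<Omega> n). \<exists>\<xi>\<in>\<Xi> n. s.deviates C w \<xi>}"
        obtain E where E: "E \<in> sets (\<Omega> n)" "measure (\<Omega> n) E \<le> real M * q n"
            "\<forall>w\<in>space (\<Omega> n) - E. risk l (P n) (fhat n w (\<xi> n)) \<le> ennreal (r + e / 2)"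
          using s.reference_probability[OF assms(20) \<xi>n, of "ennreal (r + e / 2)"]
          unfolding q_def k_def fhat by blast
        have "?bad n \<subseteq> B n \<union> ?Dev \<union> E"
        proof (rule subsetI, rule ccontr)
          fix w assume w: "w \<in> ?bad n" and no: "w \<notin> B n \<union> ?Dev \<union> E"
          have ws: "w \<in> space (\<Omega> n)" using w by simp
          have "risk l (P n) (s.fhat w (\<xi>hat n w)) \<le> ennreal (r + e)"
          proof (rule s.selected_risk_le[OF ws \<xi>n _ _ _ r(2) e _ less_imp_le[OF elim(4)] C])
            show "is_arg_min (\<lambda>\<xi>. empirical_risk cen l (Z n w) (T n w) (num_batches A n (\<Xi> n)) (b n w) (s.fhat w \<xi>))
                (\<lambda>\<xi>. \<xi> \<in> \<Xi> n) (\<xi>hat n w)"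
              unfolding fhat using elim(8) ws by blast
            show "loss_norm nk l (P n) (s.fhat w \<xi>') < ennreal (C * (1 + s.fit_risk w \<xi>'))" if "\<xi>' \<in> \<Xi> n" for \<xi>'
              unfolding s.fit_risk_def fhat using elim(2) ws no that by blast
            show "\<not> s.deviates C w \<xi>'" if "\<xi>' \<in> \<Xi> n" for \<xi>' using no ws that by blast
            show "risk l (P n) (s.fhat w (\<xi> n)) \<le> ennreal (r + e / 2)"
              unfolding fhat using E(3) ws no by blast
            show "0 < num_batches A n (\<Xi> n)"
              by (rule num_batches_bounds(1)[OF elim(9) card assms(21)])
          qed
          then show False using w above[OF e] by (simp add: fhat r(1) not_less[symmetric])
        qed
        then have "measure (\<Omega> n) (?bad n) \<le> measure (\<Omega> n) (B n) + measure (\<Omega> n) ?Dev + measure (\<Omega> n) E"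
          using elim(2) dev(1) E(1) by (intro s.W.measure_le_of_cover) auto
        also have "\<dots> < \<eta>" using elim(2,5) dev(2) E(2) by linarith
        finally show ?case by simp
      qed
    qed
  qed
qed

end
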